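(* Let $f=\sum_{i=1}^m f_i$ with $f_i:\mathbb{R}^d\to\mathbb{R}$. Assume that: (i) each $f_i$ is convex and has $L$-Lipschitz continuous gradient, i.e. $f_i(x)+\langle\nabla f_i(x),y-x\rangle\le f_i(y)\le f_i(x)+\langle\nabla f_i(x),y-x\rangle+\frac L2\|y-x\|^2$ for all $x,y\in\mathbb{R}^d$; (ii) $f$ is $\mu$-strongly convex with $\mu>0$; (iii) $f_i(x)=\ell(a_i^Tx,b_i)$ with $a_i\in\mathbb{R}^d$, $b_i\in\mathbb{R}$, and $\mathrm{supp}(\nabla f_i(x))=\mathrm{supp}(a_i)$ for every $x$ and $i$. Let $\Delta=\min(\Delta_{\rm ave},\Delta_{\max})$, $\bar L=L\sqrt{m(1+\Delta)}$ and $\sigma=\min\big(\sqrt{m(1+\Delta_{\rm ave})},1+\Delta_{\max}\big)$. Let $Q$ be an unbiased random quantizer with variance parameter $\alpha$, let $\tau_k^i\le\tau$ for all $i,k$, let $\theta>0$, and suppose $0<\gamma<\bar\gamma$ where $$\bar\gamma=\frac{2\mu}{1+m\sigma\alpha L^2\left(2\bar L^2\tau^2+(1+\theta)\right)}.$$ Then the iterates generated by $$x_{k+1}=x_k-\gamma\sum_{i=1}^mQ\big(\nabla f_i(x_{k-\tau_k^i})\big)$$ satisfy, for all $k\in\mathbb{N}$, $$\mathbf{E}\|x_k-x^\star\|^2\le(p+q)^{k/(1+2\tau)}\|x_0-x^\star\|^2+\frac{e}{1-p-q},$$ where $$p=1-2\mu\gamma+\gamma^2,\qquad q=2m\sigma\alpha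 L^2\gamma^2\bar L^2\tau^2+(1+\theta)\gamma^2m\alpha\sigma L^2,$$ $$e=\left(2m\alpha\gamma^2\bar L^2\tau^2+(1+1/\theta)\gamma^2\sigma\alpha\right)\sum_{i=1}^m\|\nabla f_i(x^\star)\|^2.$$
   Context: $\|\cdot\|$ is the Euclidean norm and $\mathrm{supp}(x)=\{i: x^i\ne0\}$. $x^\star$ is the minimizer of $f$. $x_0\in\mathbb{R}^d$ is a deterministic initial point. The delays $\tau_k^i$ are nonnegative integers, $\tau$ is a nonnegative integer, and $x_k:=x_0$ for $k<0$. Conflict graph degrees: $\Delta_{\rm ave}=\frac1m\sum_{i=1}^m\sum_{j\ne i}\mathbf 1\{\mathrm{supp}(a_i)\cap\mathrm{supp}(a_j)\ne\emptyset\}$ and $\Delta_{\max}=\max_{i}\sum_{j\ne i}\mathbf 1\{\mathrm{supp}(a_i)\cap\mathrm{supp}(a_j)\ne\emptyset\}$. An unbiased random quantizer (URQ) with parameter $\alpha$ (finite, positive) is a random mapping $Q:\mathbb{R}^d\to\mathbb{R}^d$ such that for every $v\in\mathbb{R}^d$: $\mathrm{supp}(Q(v))\subseteq\mathrm{supp}(v)$, $\mathbf{E}\{Q(v)\}=v$, and $\mathbf{E}\{\|Q(v)\|^2\}\le\alpha\|v\|^2$. Each application of $Q$ in the algorithm uses fresh randomness, so these properties hold conditionally on the past iterates. *)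

theory Defs
  imports "HOL-Probability.Probability"
begin

definition vsupp :: "real ^ 'd \<Rightarrow> 'd set" where
  "vsupp v = {i. v $ i \<noteq> 0}"

definition strongly_convex :: "real \<Rightarrow> ('a::real_inner \<Rightarrow> real) \<Rightarrow> bool" where
  "strongly_convex \<mu> f \<longleftrightarrow>
     (\<forall>x y. \<forall>t\<in>{0..1}. f ((1 - t) *\<^sub>R x + t *\<^sub>R y)
        \<le> (1 - t) * f x + t * f y - \<mu> / 2 * t * (1 - t) * (norm (x - y))\<^sup>2)"

definition conflict_degree :: "nat \<Rightarrow> (nat \<Rightarrow> real ^ 'd) \<Rightarrow> nat \<Rightarrow> nat" where
  "conflict_degree m a i = card {j \<in> {1..m}. j \<noteq> i \<and> vsupp (a i) \<inter> vsupp (a j) \<noteq> {}}"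

definition Delta_ave :: "nat \<Rightarrow> (nat \<Rightarrow> real ^ 'd) \<Rightarrow> real" where
  "Delta_ave m a = (1 / real m) * (\<Sum>i=1..m. real (conflict_degree m a i))"

definition Delta_max :: "nat \<Rightarrow> (nat \<Rightarrow> real ^ 'd) \<Rightarrow> real" where
  "Delta_max m a = real (Max (conflict_degree m a ` {1..m}))"

(* The random mapping Q is a jointly measurable map of a random seed, drawn from the
   probability space W, and of the vector to be quantized.  Integrability is stated
   explicitly because the Bochner integral of a non-integrable function is 0. *)
definition unbiased_random_quantizer ::
    "'s measure \<Rightarrow> ('s \<Rightarrow> real ^ 'd \<Rightarrow> real ^ 'd) \<Rightarrow> real \<Rightarrow> bool" where
  "unbiased_random_quantizer W Q \<alpha> \<longleftrightarrow>
     prob_space W \<and> 0 < \<alpha> \<and>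
     (\<lambda>(s, v). Q s v) \<in> borel_measurable (W \<Otimes>\<^sub>M borel) \<and>
     (\<forall>v. (AE s in W. vsupp (Q s v) \<subseteq> vsupp v) \<and>
          integrable W (\<lambda>s. Q s v) \<and> (\<integral>s. Q s v \<partial>W) = v \<and>
          integrable W (\<lambda>s. (norm (Q s v))\<^sup>2) \<and>
          (\<integral>s. (norm (Q s v))\<^sup>2 \<partial>W) \<le> \<alpha> * (norm v)\<^sup>2)"

(* Fresh randomness: every application of the quantizer, indexed by the iteration k and the
   component i, uses its own seed, and all these seeds are independent with law W. *)
definition fresh_seeds ::
    "'w measure \<Rightarrow> 's measure \<Rightarrow> nat \<Rightarrow> (nat \<Rightarrow> nat \<Rightarrow> 'w \<Rightarrow> 's) \<Rightarrow> bool" where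
  "fresh_seeds M W m \<xi> \<longleftrightarrow>
     prob_space.indep_vars M (\<lambda>_. W) (\<lambda>(k, i). \<xi> k i) (UNIV \<times> {1..m}) \<and>
     (\<forall>k. \<forall>i\<in>{1..m}. distr M W (\<xi> k i) = W)"

(* The iterates are indexed by integers so that x_k = x_0 can be imposed for k < 0. *)
definition quantized_delayed_iterates ::
    "'w measure \<Rightarrow> ('s \<Rightarrow> real ^ 'd \<Rightarrow> real ^ 'd) \<Rightarrow> (nat \<Rightarrow> nat \<Rightarrow> 'w \<Rightarrow> 's) \<Rightarrow> nat \<Rightarrow>
     (nat \<Rightarrow> real ^ 'd \<Rightarrow> real ^ 'd) \<Rightarrow> (nat \<Rightarrow> nat \<Rightarrow> nat) \<Rightarrow> real \<Rightarrow> real ^ 'd \<Rightarrow>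
     (int \<Rightarrow> 'w \<Rightarrow> real ^ 'd) \<Rightarrow> bool" where
  "quantized_delayed_iterates M Q \<xi> m g delay \<gamma> x0 x \<longleftrightarrow>
     (\<forall>\<omega>\<in>space M.
        (\<forall>k\<le>0. x k \<omega> = x0) \<and>
        (\<forall>k::nat. x (int k + 1) \<omega> = x (int k) \<omega> -
           \<gamma> *\<^sub>R (\<Sum>i=1..m. Q (\<xi> k i \<omega>) (g i (x (int k - int (delay k i)) \<omega>)))))"

(* For differentiable functions, "convex with L-Lipschitz gradient" amounts to the
   two-sided quadratic bound. *)
lemma convex_lipschitz_gradient_iff:
  fixes f :: "real ^ 'd \<Rightarrow> real" and g :: "real ^ 'd \<Rightarrow> real ^ 'd"
  assumes gd: "\<And>x. GDERIV f x :> g x"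
  shows "convex_on UNIV f \<and> L-lipschitz_on UNIV g \<longleftrightarrow>
    (\<forall>x y. f x + g x \<bullet> (y - x) \<le> f y \<and>
           f y \<le> f x + g x \<bullet> (y - x) + L / 2 * (norm (y - x))\<^sup>2)" (is "?A \<longleftrightarrow> ?B")
proof
  assume A: ?A
  show ?B
  proof (intro allI conjI)
    fix x y :: "real ^ 'd"
    define d where "d = y - x"
    define h where "h t = f (x + t *\<^sub>R d)" for t :: real
    have dh: "(h has_real_derivative (g (x + t *\<^sub>R d) \<bullet> d)) (at t)" for t
      unfolding has_field_derivative_def h_def
      by (rule has_derivative_eq_rhs,
          rule has_derivative_compose[OF _ gd[unfolded gderiv_def]])
         (auto intro!: derivative_eq_intros simp: inner_commute fun_eq_iff)
    have "convex_on UNIV h"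
    proof (rule convex_onI)
      fix t u v :: real assume t: "0 < t" "t < 1"
      have "x + ((1 - t) *\<^sub>R u + t *\<^sub>R v) *\<^sub>R d = (1 - t) *\<^sub>R (x + u *\<^sub>R d) + t *\<^sub>R (x + v *\<^sub>R d)"
        by (simp add: algebra_simps)
      then show "h ((1 - t) *\<^sub>R u + t *\<^sub>R v) \<le> (1 - t) * h u + t * h v"
        using convex_onD[of UNIV f t "x + u *\<^sub>R d" "x + v *\<^sub>R d"] A t by (simp add: h_def)
    qed simp
    from convex_on_imp_above_tangent[OF this, of 0 1 "g x \<bullet> d"] dh[of 0]
    have "h 1 - h 0 \<ge> g x \<bullet> d" by simp
    then show "f x + g x \<bullet> (y - x) \<le> f y" by (simp add: h_def d_def)
    define p where "p t = h t - t * (g x \<bullet> d) - L / 2 * t\<^sup>2 * (norm d)\<^sup>2" for t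
    have dp: "(p has_real_derivative ((g (x + t *\<^sub>R d) - g x) \<bullet> d - L * t * (norm d)\<^sup>2)) (at t)" for t
      unfolding p_def by (auto intro!: derivative_eq_intros dh simp: inner_diff_left)
    have "p 1 \<le> p 0"
    proof (rule DERIV_nonpos_imp_nonincreasing[of 0 1 p])
      fix t :: real assume t: "0 \<le> t" "t \<le> 1"
      have "(g (x + t *\<^sub>R d) - g x) \<bullet> d \<le> norm (g (x + t *\<^sub>R d) - g x) * norm d"
        by (rule norm_cauchy_schwarz)
      also have "\<dots> \<le> (L * norm (t *\<^sub>R d)) * norm d"
        using lipschitz_onD[of L UNIV g "x + t *\<^sub>R d" x] A
        by (intro mult_right_mono) (auto simp: dist_norm)
      also have "\<dots> = L * t * (norm d)\<^sup>2" using t by (simp add: power2_eq_square)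
      finally have "(g (x + t *\<^sub>R d) - g x) \<bullet> d - L * t * (norm d)\<^sup>2 \<le> 0" by simp
      then show "\<exists>y. (p has_real_derivative y) (at t) \<and> y \<le> 0" using dp by blast
    qed simp
    then show "f y \<le> f x + g x \<bullet> (y - x) + L / 2 * (norm (y - x))\<^sup>2"
      by (simp add: p_def h_def d_def)
  qed
next
  assume ?B
  then have lo: "f x + g x \<bullet> (y - x) \<le> f y"
    and up: "f y \<le> f x + g x \<bullet> (y - x) + L / 2 * (norm (y - x))\<^sup>2" for x y by auto
  obtain e :: "real ^ 'd" where e: "norm e = 1" using vector_choose_size[of 1] by auto
  have L0: "0 \<le> L" using lo[of 0 e] up[of e 0] e by simp
  have cvx: "convex_on UNIV f"
  proof (rule convex_onI)
    fix t :: real and x y :: "real ^ 'd" assume t: "0 < t" "t < 1"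
    define z where "z = (1 - t) *\<^sub>R x + t *\<^sub>R y"
    have "(1 - t) * (f z + g z \<bullet> (x - z)) + t * (f z + g z \<bullet> (y - z)) \<le> (1 - t) * f x + t * f y"
      using t lo by (intro add_mono mult_left_mono) auto
    moreover have "(1 - t) * (f z + g z \<bullet> (x - z)) + t * (f z + g z \<bullet> (y - z))
        = f z + g z \<bullet> ((1 - t) *\<^sub>R (x - z) + t *\<^sub>R (y - z))"
      by (simp add: inner_add_right algebra_simps)
    moreover have "(1 - t) *\<^sub>R (x - z) + t *\<^sub>R (y - z) = 0"
      by (simp add: z_def algebra_simps)
    ultimately show "f ((1 - t) *\<^sub>R x + t *\<^sub>R y) \<le> (1 - t) * f x + t * f y"
      by (simp add: z_def)
  qed simp
  have half: "s * (norm (g y - g x))\<^sup>2 - L / 2 * s\<^sup>2 * (norm (g y - g x))\<^sup>2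
      \<le> f y - f x - g x \<bullet> (y - x)" for x y and s :: real
  proof -
    define w where "w = g y - g x"
    have "f x + g x \<bullet> ((y - s *\<^sub>R w) - x) \<le> f y + g y \<bullet> (- (s *\<^sub>R w)) + L / 2 * (norm (s *\<^sub>R w))\<^sup>2"
      using lo[of x "y - s *\<^sub>R w"] up[of "y - s *\<^sub>R w" y] by simp
    then have "s * (g y \<bullet> w - g x \<bullet> w) - L / 2 * s\<^sup>2 * (norm w)\<^sup>2 \<le> f y - f x - g x \<bullet> (y - x)"
      by (simp add: algebra_simps inner_diff_right power_mult_distrib)
    moreover have "g y \<bullet> w - g x \<bullet> w = (norm w)\<^sup>2"
      by (simp add: w_def power2_norm_eq_inner inner_diff_left)
    ultimately show ?thesis by (simp add: w_def)
  qed
  have co: "2 * s * (norm (g y - g x))\<^sup>2 - L * s\<^sup>2 * (norm (g y - g x))\<^sup>2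
      \<le> (g y - g x) \<bullet> (y - x)" for x y and s :: real
    using half[of s y x] half[of s x y]
    by (simp add: norm_minus_commute inner_diff_left inner_diff_right algebra_simps)
  have "norm (g y - g x) \<le> L * norm (y - x)" for x y
  proof (cases "g y = g x")
    case True then show ?thesis using L0 by simp
  next
    case False
    define n where "n = norm (g y - g x)"
    have n: "n > 0" using False by (simp add: n_def)
    have cs: "(g y - g x) \<bullet> (y - x) \<le> n * norm (y - x)"
      unfolding n_def by (rule norm_cauchy_schwarz)
    have c: "2 * s * n\<^sup>2 - L * s\<^sup>2 * n\<^sup>2 \<le> n * norm (y - x)" for s
      using co[of s y x] cs unfolding n_def by linarith
    have c': "2 * s * n - L * s\<^sup>2 * n \<le> norm (y - x)" for s
    proof -
      have "n * (2 * s * n - L * s\<^sup>2 * n) \<le> n * norm (y - x)"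
        using c[of s] by (simp add: algebra_simps power2_eq_square)
      then show ?thesis using n by simp
    qed
    show ?thesis
    proof (cases "L = 0")
      case True
      have "2 * (norm (y - x) / n) * n \<le> norm (y - x)" using c'[of "norm (y - x) / n"] True by simp
      then have "norm (y - x) = 0" using n by simp
      then show ?thesis using False by simp
    next
      case L: False
      then have "2 * (1 / L) * n - L * (1 / L)\<^sup>2 * n = n / L"
        by (simp add: field_simps power2_eq_square)
      with c'[of "1 / L"] have "n / L \<le> norm (y - x)" by simp
      then show ?thesis using L L0 by (simp add: n_def field_simps)
    qed
  qed
  then have "L-lipschitz_on UNIV g"
    using L0 by (intro lipschitz_onI) (auto simp: dist_norm)
  with cvx show ?A by blast
qed

end

theory Submission
  imports Defs
begin

text \<open>
  Let \<open>V\<^sub>k\<close> be the mean squared distance of the k-th iterate from the minimizer. The proof bounds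
  \<open>V\<^sub>k\<^sub>+\<^sub>1\<close> by \<open>(p + q) B + e\<close> whenever B bounds the errors of the rounds k - 2 \<tau>, ..., k. Such a recurrence
  with bounded delay contracts by p + q once every 1 + 2 \<tau> rounds
  (\<open>delayed_recurrence_bound\<close>), and the step size condition says precisely that p + q < 1.

  For the recurrence, the square of \<open>x\<^sub>k\<^sub>+\<^sub>1 - x\<^sup>\<star>\<close> is expanded (\<open>error_Suc\<close>). The seeds of round k are
  independent of the iterates up to round k, so they are integrated out first (\<open>nn_integral_fresh\<close>,
  \<open>integral_fresh\<close>): the cross term then contains the stale gradients instead of their quantizations.
  Their sum is the gradient of the objective at the current iterate, for which strong monotonicity
  gives the contraction, plus a perturbation caused by the delays. The perturbation is controlled by the
  lengths of the last \<tau> steps, and these by the errors of the last 2 \<tau> rounds and the gradients at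
  the minimizer. Sparsity comes in twice: the squared norm of a sum of vectors whose overlaps are
  described by the conflict graph is at most the number of conflicting pairs times the largest squared
  norm (\<open>norm_sum_le_card_conflict_pairs\<close>, used for the perturbation and responsible for the
  constant Lbar), and at most \<sigma> times the sum of the squared norms
  (\<open>norm_sum_le_conflict_factor\<close>, used for the quantized steps).

  One point needs care: \<open>p = 1 - 2 \<mu> \<gamma> + \<gamma>\<^sup>2\<close> can be negative for admissible step sizes, and then
  \<open>p V\<^sub>k\<close> is not bounded by \<open>p B\<close>. Without delays all terms involve the same \<open>V\<^sub>k\<close>, and p + q > 0
  suffices. With delays, Young's inequality in the cross term is applied with another weight, chosen
  such that the coefficient of \<open>V\<^sub>k\<close> becomes 0; the loss is compensated in q since \<mu> is at most the
  Lipschitz constant of the total gradient (\<open>strong_monotonicity_constant_le\<close>) and since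
  \<open>\<alpha> \<ge> 1\<close> (\<open>quantizer_variance_ge_1\<close>). The same two facts yield p + q > 0.
\<close>

section \<open>Sums of vectors with overlapping supports\<close>

text \<open>The edges of the conflict graph in both directions, together with the diagonal: these are
  the only pairs of indices for which an inner product of two summands can be nonzero.\<close>

definition conflict_pairs :: "nat \<Rightarrow> (nat \<Rightarrow> real ^ 'd) \<Rightarrow> (nat \<times> nat) set" where
  "conflict_pairs m a =
     {(i, j) \<in> {1..m} \<times> {1..m}. i = j \<or> vsupp (a i) \<inter> vsupp (a j) \<noteq> {}}"

definition conflict_factor :: "nat \<Rightarrow> (nat \<Rightarrow> real ^ 'd) \<Rightarrow> real" where
  "conflict_factor m a = min (sqrt (real m * (1 + Delta_ave m a))) (1 + Delta_max m a)"

lemma finite_conflict_pairs [simp]: "finite (conflict_pairs m a)"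
  by (rule finite_subset[of _ "{1..m} \<times> {1..m}"]) (auto simp: conflict_pairs_def)

lemma sum_conflict_pairs_fst:
  "(\<Sum>(i, j)\<in>conflict_pairs m a. h i) = (\<Sum>i=1..m. (1 + real (conflict_degree m a i)) * h i)"
proof -
  let ?N = "\<lambda>i. {j \<in> {1..m}. j \<noteq> i \<and> vsupp (a i) \<inter> vsupp (a j) \<noteq> {}}"
  have "conflict_pairs m a = (SIGMA i:{1..m}. insert i (?N i))"
    by (auto simp: conflict_pairs_def)
  then have "(\<Sum>(i, j)\<in>conflict_pairs m a. h i) = (\<Sum>i=1..m. \<Sum>j\<in>insert i (?N i). h i)"
    by (subst sum.Sigma) (auto simp del: sum_constant)
  also have "\<dots> = (\<Sum>i=1..m. (1 + real (conflict_degree m a i)) * h i)"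
    by (intro sum.cong) (auto simp: conflict_degree_def)
  finally show ?thesis .
qed

lemma sum_conflict_pairs_snd:
  "(\<Sum>(i, j)\<in>conflict_pairs m a. h j) = (\<Sum>(i, j)\<in>conflict_pairs m a. h i)"
  by (rule sum.reindex_bij_witness[of _ prod.swap prod.swap]) (auto simp: conflict_pairs_def)

lemma card_conflict_pairs:
  assumes "1 \<le> m"
  shows "real (card (conflict_pairs m a)) = real m * (1 + Delta_ave m a)"
  using sum_conflict_pairs_fst[of "\<lambda>_. 1" m a] assms
  by (simp add: Delta_ave_def sum.distrib field_simps)

lemma conflict_degree_le_Delta_max:
  "i \<in> {1..m} \<Longrightarrow> real (conflict_degree m a i) \<le> Delta_max m a"
  by (simp add: Delta_max_def)

lemma conflict_degree_less: "i \<in> {1..m} \<Longrightarrow> conflict_degree m a i < m"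
proof -
  assume i: "i \<in> {1..m}"
  have "conflict_degree m a i \<le> card ({1..m} - {i})"
    unfolding conflict_degree_def by (intro card_mono) auto
  also have "\<dots> < m" using i by simp
  finally show ?thesis .
qed

lemma Delta_ave_le_Delta_max:
  assumes "1 \<le> m"
  shows "Delta_ave m a \<le> Delta_max m a"
proof -
  have "(\<Sum>i=1..m. real (conflict_degree m a i)) \<le> (\<Sum>i=1..m. Delta_max m a)"
    by (intro sum_mono conflict_degree_le_Delta_max)
  with assms show ?thesis by (simp add: Delta_ave_def field_simps)
qed

lemma Delta_ave_nonneg: "0 \<le> Delta_ave m a"
  by (simp add: Delta_ave_def sum_nonneg)

lemma conflict_factor_nonneg: "0 \<le> conflict_factor m a"
  using Delta_ave_nonneg[of m a] by (simp add: conflict_factor_def Delta_max_def)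

lemma conflict_factor_le:
  assumes "1 \<le> m"
  shows "conflict_factor m a \<le> real m"
proof -
  have "Max (conflict_degree m a ` {1..m}) < m"
    using assms conflict_degree_less[of _ m a] by (subst Max_less_iff) auto
  then show ?thesis by (simp add: conflict_factor_def Delta_max_def)
qed

lemma inner_disjoint_vsupp: "vsupp u \<inter> vsupp v = {} \<Longrightarrow> u \<bullet> v = 0"
  by (auto simp: vsupp_def inner_vec_def intro!: sum.neutral)

text \<open>Expanding the square leaves only the squares of the summands and the inner products
  of those whose supports meet.\<close>

lemma norm_sum_le_conflict_pairs:
  assumes "\<And>i. i \<in> {1..m} \<Longrightarrow> vsupp (v i) \<subseteq> vsupp (a i)"
  shows "(norm (\<Sum>i=1..m. v i))\<^sup>2 \<le> (\<Sum>(i, j)\<in>conflict_pairs m a. norm (v i) * norm (v j))"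
proof -
  have "(norm (\<Sum>i=1..m. v i))\<^sup>2 = (\<Sum>(i, j)\<in>{1..m} \<times> {1..m}. v i \<bullet> v j)"
    by (simp add: power2_norm_eq_inner inner_sum_left inner_sum_right sum.cartesian_product split_def inner_commute)
  also have "\<dots> = (\<Sum>(i, j)\<in>conflict_pairs m a. v i \<bullet> v j)"
    using assms
    by (intro sum.mono_neutral_right) (fastforce simp: conflict_pairs_def intro: inner_disjoint_vsupp)+
  also have "\<dots> \<le> (\<Sum>(i, j)\<in>conflict_pairs m a. norm (v i) * norm (v j))"
    by (intro sum_mono) (auto intro: norm_cauchy_schwarz)
  finally show ?thesis .
qed

lemma norm_sum_le_card_conflict_pairs:
  assumes "\<And>i. i \<in> {1..m} \<Longrightarrow> vsupp (v i) \<subseteq> vsupp (a i)"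
    and "\<And>i. i \<in> {1..m} \<Longrightarrow> norm (v i) \<le> B"
  shows "(norm (\<Sum>i=1..m. v i))\<^sup>2 \<le> real (card (conflict_pairs m a)) * B\<^sup>2"
proof -
  have "norm (v i) * norm (v j) \<le> B\<^sup>2" if "(i, j) \<in> conflict_pairs m a" for i j
    using assms(2)[of i] assms(2)[of j] that
    by (auto simp: conflict_pairs_def power2_eq_square intro!: mult_mono order_trans[OF norm_ge_zero])
  then have "(\<Sum>(i, j)\<in>conflict_pairs m a. norm (v i) * norm (v j))
      \<le> (\<Sum>(i, j)\<in>conflict_pairs m a. B\<^sup>2)"
    by (intro sum_mono) auto
  with norm_sum_le_conflict_pairs[of m v a] assms(1) show ?thesis by simp
qed

text \<open>The sum over conflicting pairs is a quadratic form in the norms of the summands, given by the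
  adjacency matrix of the conflict graph plus the identity. Its spectral norm is at most the largest
  row sum, by the arithmetic-geometric mean inequality, and at most the Frobenius norm, by
  Cauchy--Schwarz; the conflict factor is the smaller of the two.\<close>

lemma norm_sum_le_conflict_factor:
  assumes m: "1 \<le> m" and v: "\<And>i. i \<in> {1..m} \<Longrightarrow> vsupp (v i) \<subseteq> vsupp (a i)"
  shows "(norm (\<Sum>i=1..m. v i))\<^sup>2 \<le> conflict_factor m a * (\<Sum>i=1..m. (norm (v i))\<^sup>2)"
proof -
  let ?C = "conflict_pairs m a" and ?S = "\<Sum>i=1..m. (norm (v i))\<^sup>2"
  have S: "0 \<le> ?S" by (simp add: sum_nonneg)
  \<comment> \<open>Row sums: each pair is split evenly, and symmetry of the conflict graph recombines the halves.\<close>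
  have "(\<Sum>(i, j)\<in>?C. norm (v i) * norm (v j))
      \<le> (\<Sum>(i, j)\<in>?C. ((norm (v i))\<^sup>2 + (norm (v j))\<^sup>2) / 2)"
  proof (intro sum_mono, clarify)
    fix i j
    show "norm (v i) * norm (v j) \<le> ((norm (v i))\<^sup>2 + (norm (v j))\<^sup>2) / 2"
      using sum_squares_bound[of "norm (v i)" "norm (v j)"] by simp
  qed
  also have "\<dots> = ((\<Sum>(i, j)\<in>?C. (norm (v i))\<^sup>2) + (\<Sum>(i, j)\<in>?C. (norm (v j))\<^sup>2)) / 2"
    by (simp add: split_def flip: sum.distrib sum_divide_distrib)
  also have "\<dots> = (\<Sum>(i, j)\<in>?C. (norm (v i))\<^sup>2)"
    using sum_conflict_pairs_snd[of "\<lambda>j. (norm (v j))\<^sup>2" m a] by simp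
  also have "\<dots> = (\<Sum>i=1..m. (1 + real (conflict_degree m a i)) * (norm (v i))\<^sup>2)"
    by (rule sum_conflict_pairs_fst)
  also have "\<dots> \<le> (\<Sum>i=1..m. (1 + Delta_max m a) * (norm (v i))\<^sup>2)"
    by (intro sum_mono mult_right_mono add_left_mono conflict_degree_le_Delta_max) auto
  finally have le_max: "(\<Sum>(i, j)\<in>?C. norm (v i) * norm (v j)) \<le> (1 + Delta_max m a) * ?S"
    by (simp add: sum_distrib_left)
  \<comment> \<open>Frobenius norm: Cauchy--Schwarz against the constant 1, then enlarging to all pairs.\<close>
  have "(\<Sum>(i, j)\<in>?C. norm (v i) * norm (v j))\<^sup>2
      \<le> (\<Sum>(i, j)\<in>?C. 1\<^sup>2) * (\<Sum>(i, j)\<in>?C. (norm (v i) * norm (v j))\<^sup>2)"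
    using Cauchy_Schwarz_ineq_sum[of "\<lambda>_. 1" "\<lambda>(i, j). norm (v i) * norm (v j)" ?C]
    by (simp add: split_def)
  also have "(\<Sum>(i, j)\<in>?C. (norm (v i) * norm (v j))\<^sup>2)
      \<le> (\<Sum>(i, j)\<in>{1..m} \<times> {1..m}. (norm (v i) * norm (v j))\<^sup>2)"
    by (intro sum_mono2) (auto simp: conflict_pairs_def)
  also have "\<dots> = ?S\<^sup>2"
    unfolding power2_eq_square[of ?S] sum_product
    by (simp add: sum.cartesian_product power_mult_distrib)
  finally have "(\<Sum>(i, j)\<in>?C. norm (v i) * norm (v j))\<^sup>2
      \<le> (sqrt (real m * (1 + Delta_ave m a)) * ?S)\<^sup>2"
    using card_conflict_pairs[OF m, of a] Delta_ave_nonneg[of m a]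
    by (simp add: power_mult_distrib mult_left_mono)
  then have le_ave: "(\<Sum>(i, j)\<in>?C. norm (v i) * norm (v j)) \<le> sqrt (real m * (1 + Delta_ave m a)) * ?S"
    by (rule power2_le_imp_le) (use S Delta_ave_nonneg[of m a] in simp)
  show ?thesis
    using norm_sum_le_conflict_pairs[of m v a] v le_max le_ave
    by (fastforce simp: conflict_factor_def min_def)
qed

section \<open>Strong convexity\<close>

text \<open>The slack \<phi> in the strong convexity inequality along the segment from x to y is nonnegative
  and vanishes at x, so its derivative there cannot be negative.\<close>

lemma strongly_convex_above_tangent:
  fixes F :: "real ^ 'd \<Rightarrow> real"
  assumes "strongly_convex \<mu> F" and dF: "GDERIV F x :> u"
  shows "F x + u \<bullet> (y - x) + \<mu> / 2 * (norm (x - y))\<^sup>2 \<le> F y"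
proof -
  define \<phi> where "\<phi> t = (1 - t) * F x + t * F y - \<mu> / 2 * t * (1 - t) * (norm (x - y))\<^sup>2
    - F (x + t *\<^sub>R (y - x))" for t :: real
  have nonneg: "0 \<le> \<phi> t" if "t \<in> {0..1}" for t
  proof -
    have "x + t *\<^sub>R (y - x) = (1 - t) *\<^sub>R x + t *\<^sub>R y" by (simp add: algebra_simps)
    with assms(1) that show ?thesis by (simp add: \<phi>_def strongly_convex_def)
  qed
  have "((\<lambda>t. F (x + t *\<^sub>R (y - x))) has_real_derivative u \<bullet> (y - x)) (at 0)"
    unfolding has_field_derivative_def
    by (rule has_derivative_eq_rhs, rule has_derivative_compose[of _ "\<lambda>t. t *\<^sub>R (y - x)" _ _ F])
       (use dF in \<open>auto simp: gderiv_def inner_commute fun_eq_iff intro!: derivative_eq_intros\<close>)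
  then have "(\<phi> has_real_derivative F y - F x - \<mu> / 2 * (norm (x - y))\<^sup>2 - u \<bullet> (y - x)) (at 0)"
    unfolding \<phi>_def[abs_def] by (auto intro!: derivative_eq_intros simp: algebra_simps)
  then have "0 \<le> F y - F x - \<mu> / 2 * (norm (x - y))\<^sup>2 - u \<bullet> (y - x)"
  proof (rule contrapos_pp)
    assume neg: "\<not> ?thesis"
    show "\<not> (\<phi> has_real_derivative F y - F x - \<mu> / 2 * (norm (x - y))\<^sup>2 - u \<bullet> (y - x)) (at 0)"
    proof
      assume "(\<phi> has_real_derivative F y - F x - \<mu> / 2 * (norm (x - y))\<^sup>2 - u \<bullet> (y - x)) (at 0)"
      from DERIV_neg_dec_right[OF this] neg obtain \<delta>
        where \<delta>: "0 < \<delta>" "\<And>h. 0 < h \<Longrightarrow> h < \<delta> \<Longrightarrow> \<phi> (0 + h) < \<phi> 0" by auto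
      have "\<phi> (min (\<delta> / 2) 1) < \<phi> 0" using \<delta>(1) \<delta>(2)[of "min (\<delta> / 2) 1"] by simp
      with nonneg[of "min (\<delta> / 2) 1"] \<delta>(1) show False by (simp add: \<phi>_def)
    qed
  qed
  then show ?thesis by simp
qed

lemma strongly_convex_strongly_monotone:
  fixes F :: "real ^ 'd \<Rightarrow> real"
  assumes "strongly_convex \<mu> F" "GDERIV F x :> u" "GDERIV F y :> v"
  shows "\<mu> * (norm (x - y))\<^sup>2 \<le> (u - v) \<bullet> (x - y)"
  using strongly_convex_above_tangent[OF assms(1,2), of y]
    strongly_convex_above_tangent[OF assms(1,3), of x]
  by (simp add: norm_minus_commute inner_diff_left inner_diff_right algebra_simps)

lemma GDERIV_sum:
  assumes "\<And>i. i \<in> I \<Longrightarrow> GDERIV (f i) x :> df i"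
  shows "GDERIV (\<lambda>x. \<Sum>i\<in>I. f i x) x :> (\<Sum>i\<in>I. df i)"
  using assms unfolding gderiv_def inner_sum_right by (rule has_derivative_sum)

lemma GDERIV_minimum_eq_0:
  fixes F :: "real ^ 'd \<Rightarrow> real"
  assumes "GDERIV F x :> u" "\<And>y. F x \<le> F y"
  shows "u = 0"
proof -
  have "(\<lambda>h. h \<bullet> u) = (\<lambda>h. 0)"
    using assms unfolding gderiv_def
    by (intro differential_zero_maxmin[of x UNIV F]) auto
  then have "u \<bullet> u = 0" by meson
  then show ?thesis by simp
qed

section \<open>Square-integrable random vectors\<close>

definition square_integrable :: "'w measure \<Rightarrow> ('w \<Rightarrow> 'b::euclidean_space) \<Rightarrow> bool" where
  "square_integrable M u \<longleftrightarrow> u \<in> borel_measurable M \<and> integrable M (\<lambda>\<omega>. (norm (u \<omega>))\<^sup>2)"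

lemma square_integrableD:
  assumes "square_integrable M u"
  shows "u \<in> borel_measurable M" "integrable M (\<lambda>\<omega>. (norm (u \<omega>))\<^sup>2)"
  using assms by (auto simp: square_integrable_def)

lemma square_integrable_cong:
  assumes "square_integrable M u" "\<And>\<omega>. \<omega> \<in> space M \<Longrightarrow> v \<omega> = u \<omega>"
  shows "square_integrable M v"
  using assms measurable_cong[of M v u borel]
    Bochner_Integration.integrable_cong[of M M "\<lambda>\<omega>. (norm (v \<omega>))\<^sup>2" "\<lambda>\<omega>. (norm (u \<omega>))\<^sup>2"]
  by (simp add: square_integrable_def)

lemma (in finite_measure) square_integrable_const: "square_integrable M (\<lambda>_. c)"
  by (simp add: square_integrable_def)

lemma square_integrable_scaleR:
  "square_integrable M u \<Longrightarrow> square_integrable M (\<lambda>\<omega>. c *\<^sub>R u \<omega>)"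
  by (auto simp: square_integrable_def power_mult_distrib)

text \<open>Young's inequality. The weight t becomes \<theta> in the second moments of the stale gradients, and is
  chosen according to the sign of p in the cross term.\<close>

lemma two_inner_le:
  fixes u v :: "'b::real_inner"
  assumes "0 < t"
  shows "2 * (u \<bullet> v) \<le> t * (norm u)\<^sup>2 + (1 / t) * (norm v)\<^sup>2"
proof -
  have "0 \<le> (norm (sqrt t *\<^sub>R u - (1 / sqrt t) *\<^sub>R v))\<^sup>2" by simp
  also have "\<dots> = t * (norm u)\<^sup>2 + (1 / t) * (norm v)\<^sup>2 - 2 * (u \<bullet> v)"
    using assms
    by (simp add: power2_norm_eq_inner inner_diff_left inner_diff_right inner_commute
        real_sqrt_mult[symmetric] field_simps)
  finally show ?thesis by simp
qed

lemma norm_add_squared_le: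
  fixes u v :: "'b::real_inner"
  assumes "0 < t"
  shows "(norm (u + v))\<^sup>2 \<le> (1 + t) * (norm u)\<^sup>2 + (1 + 1 / t) * (norm v)\<^sup>2"
  using two_inner_le[OF assms, of u v]
  by (simp add: power2_norm_eq_inner inner_add_left inner_add_right inner_commute algebra_simps)

lemma square_integrable_add:
  assumes u: "square_integrable M u" and v: "square_integrable M v"
  shows "square_integrable M (\<lambda>\<omega>. u \<omega> + v \<omega>)"
  unfolding square_integrable_def
proof
  note [measurable] = square_integrableD(1)[OF u] square_integrableD(1)[OF v]
  show "(\<lambda>\<omega>. u \<omega> + v \<omega>) \<in> borel_measurable M" by measurable
  show "integrable M (\<lambda>\<omega>. (norm (u \<omega> + v \<omega>))\<^sup>2)"
  proof (rule Bochner_Integration.integrable_bound)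
    show "integrable M (\<lambda>\<omega>. 2 * (norm (u \<omega>))\<^sup>2 + 2 * (norm (v \<omega>))\<^sup>2)"
      using u v by (simp add: square_integrable_def)
    show "AE \<omega> in M. norm ((norm (u \<omega> + v \<omega>))\<^sup>2) \<le> norm (2 * (norm (u \<omega>))\<^sup>2 + 2 * (norm (v \<omega>))\<^sup>2)"
      using norm_add_squared_le[of 1 "u _" "v _"] by (intro AE_I2) simp
  qed measurable
qed

lemma square_integrable_diff:
  assumes "square_integrable M u" "square_integrable M v"
  shows "square_integrable M (\<lambda>\<omega>. u \<omega> - v \<omega>)"
  using square_integrable_add[OF assms(1) square_integrable_scaleR[OF assms(2), of "-1"]] by simp

lemma square_integrable_sum:
  assumes "\<And>i. i \<in> I \<Longrightarrow> square_integrable M (u i)"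
  shows "square_integrable M (\<lambda>\<omega>. \<Sum>i\<in>I. u i \<omega>)"
  using assms
proof (induction I rule: infinite_finite_induct)
  case (insert i I)
  then show ?case by (simp add: square_integrable_add)
qed (simp_all add: square_integrable_def)

lemma square_integrable_inner:
  assumes u: "square_integrable M u" and v: "square_integrable M v"
  shows "integrable M (\<lambda>\<omega>. u \<omega> \<bullet> v \<omega>)"
proof (rule Bochner_Integration.integrable_bound)
  show "integrable M (\<lambda>\<omega>. (norm (u \<omega>))\<^sup>2 + (norm (v \<omega>))\<^sup>2)"
    using u v by (simp add: square_integrable_def)
  show "AE \<omega> in M. norm (u \<omega> \<bullet> v \<omega>) \<le> norm ((norm (u \<omega>))\<^sup>2 + (norm (v \<omega>))\<^sup>2)"
  proof (intro AE_I2)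
    fix \<omega>
    have "\<bar>u \<omega> \<bullet> v \<omega>\<bar> \<le> norm (u \<omega>) * norm (v \<omega>)" by (rule Cauchy_Schwarz_ineq2)
    also have "\<dots> \<le> (norm (u \<omega>))\<^sup>2 + (norm (v \<omega>))\<^sup>2"
      using sum_squares_bound[of "norm (u \<omega>)" "norm (v \<omega>)"]
        mult_nonneg_nonneg[OF norm_ge_zero[of "u \<omega>"] norm_ge_zero[of "v \<omega>"]] by linarith
    finally show "norm (u \<omega> \<bullet> v \<omega>) \<le> norm ((norm (u \<omega>))\<^sup>2 + (norm (v \<omega>))\<^sup>2)" by simp
  qed
qed (use u v in \<open>auto simp: square_integrable_def\<close>)

lemma (in finite_measure) square_integrable_lipschitz:
  fixes h :: "'b::euclidean_space \<Rightarrow> 'c::euclidean_space"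
  assumes h: "L-lipschitz_on UNIV h" and u: "square_integrable M u"
  shows "square_integrable M (\<lambda>\<omega>. h (u \<omega>))"
  unfolding square_integrable_def
proof
  note [measurable] = square_integrableD(1)[OF u]
  have [measurable]: "h \<in> borel_measurable borel"
    using h by (intro borel_measurable_continuous_onI lipschitz_on_continuous_on)
  show "(\<lambda>\<omega>. h (u \<omega>)) \<in> borel_measurable M" by measurable
  show "integrable M (\<lambda>\<omega>. (norm (h (u \<omega>)))\<^sup>2)"
  proof (rule Bochner_Integration.integrable_bound)
    show "integrable M (\<lambda>\<omega>. 2 * (L\<^sup>2 * (norm (u \<omega>))\<^sup>2) + 2 * (norm (h 0))\<^sup>2)"
      using u by (simp add: square_integrable_def)
    have "norm ((norm (h v))\<^sup>2) \<le> norm (2 * (L\<^sup>2 * (norm v)\<^sup>2) + 2 * (norm (h 0))\<^sup>2)" for v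
    proof -
      have "norm (h v - h 0) \<le> L * norm v"
        using lipschitz_onD[OF h, of v 0] by (simp add: dist_norm)
      then have "(norm (h v - h 0))\<^sup>2 \<le> L\<^sup>2 * (norm v)\<^sup>2"
        by (metis norm_ge_zero power_mono power_mult_distrib)
      with norm_add_squared_le[of 1 "h v - h 0" "h 0"] show ?thesis by simp
    qed
    then show "AE \<omega> in M. norm ((norm (h (u \<omega>)))\<^sup>2)
        \<le> norm (2 * (L\<^sup>2 * (norm (u \<omega>))\<^sup>2) + 2 * (norm (h 0))\<^sup>2)" by simp
  qed measurable
qed

section \<open>Fresh randomness\<close>

context prob_space
begin

text \<open>Independence of s from Z, together with the law of s. It is stated through the joint law since
  \<^const>\<open>indep_var\<close> only relates random variables of the same type.\<close>

definition fresh_seed :: "'b measure \<Rightarrow> ('a \<Rightarrow> 'b) \<Rightarrow> 's measure \<Rightarrow> ('a \<Rightarrow> 's) \<Rightarrow> bool" where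
  "fresh_seed N Z W s \<longleftrightarrow>
     Z \<in> M \<rightarrow>\<^sub>M N \<and> s \<in> M \<rightarrow>\<^sub>M W \<and> distr M W s = W \<and>
     distr M N Z \<Otimes>\<^sub>M W = distr M (N \<Otimes>\<^sub>M W) (\<lambda>\<omega>. (Z \<omega>, s \<omega>))"

lemma
  assumes fresh: "fresh_seed N Z W s"
  shows fresh_seed_rv1: "Z \<in> M \<rightarrow>\<^sub>M N"
    and fresh_seed_rv2: "s \<in> M \<rightarrow>\<^sub>M W"
    and fresh_seed_prob_space: "prob_space W"
    and fresh_seed_joint_distr: "distr M N Z \<Otimes>\<^sub>M W = distr M (N \<Otimes>\<^sub>M W) (\<lambda>\<omega>. (Z \<omega>, s \<omega>))"
    and fresh_seed_measurable: "(\<lambda>\<omega>. (Z \<omega>, s \<omega>)) \<in> M \<rightarrow>\<^sub>M N \<Otimes>\<^sub>M W"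
  using fresh prob_space_distr[of s W] by (auto simp: fresh_seed_def)

lemma fresh_seed_compose:
  assumes fresh: "fresh_seed N Z W s" and \<phi>: "\<phi> \<in> N \<rightarrow>\<^sub>M N'"
  shows "fresh_seed N' (\<lambda>\<omega>. \<phi> (Z \<omega>)) W s"
proof -
  interpret W: prob_space W by (rule fresh_seed_prob_space[OF fresh])
  note rv = fresh_seed_rv1[OF fresh] fresh_seed_rv2[OF fresh]
  have "distr M N' (\<lambda>\<omega>. \<phi> (Z \<omega>)) \<Otimes>\<^sub>M W = distr (distr M N Z) N' \<phi> \<Otimes>\<^sub>M distr W W (\<lambda>t. t)"
    using rv \<phi> by (simp add: distr_distr comp_def)
  also have "\<dots> = distr (distr M N Z \<Otimes>\<^sub>M W) (N' \<Otimes>\<^sub>M W) (\<lambda>(z, t). (\<phi> z, t))"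
    using \<phi> W.sigma_finite_measure_axioms by (intro pair_measure_distr) auto
  also have "\<dots> = distr M (N' \<Otimes>\<^sub>M W) (\<lambda>\<omega>. (\<phi> (Z \<omega>), s \<omega>))"
    using \<phi> unfolding fresh_seed_joint_distr[OF fresh]
    by (subst distr_distr) (auto simp: comp_def intro: fresh_seed_measurable[OF fresh])
  finally show ?thesis
    using fresh rv \<phi> by (auto simp: fresh_seed_def)
qed

lemma fresh_seed_cong:
  assumes fresh: "fresh_seed N Z W s"
    and eq: "\<And>\<omega>. \<omega> \<in> space M \<Longrightarrow> Z' \<omega> = Z \<omega>" "\<And>\<omega>. \<omega> \<in> space M \<Longrightarrow> s' \<omega> = s \<omega>"
  shows "fresh_seed N Z' W s'"
  using fresh measurable_cong[of M Z' Z N] measurable_cong[of M s' s W] eq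
    distr_cong[of M M N N Z' Z] distr_cong[of M M W W s' s]
    distr_cong[of M M "N \<Otimes>\<^sub>M W" "N \<Otimes>\<^sub>M W" "\<lambda>\<omega>. (Z' \<omega>, s' \<omega>)" "\<lambda>\<omega>. (Z \<omega>, s \<omega>)"]
  by (simp add: fresh_seed_def)

text \<open>Independence of the families indexed by the disjoint sets J and {p} is a statement about two
  product spaces; projecting the second one onto its only coordinate gives the claim.\<close>

lemma indep_vars_fresh_seed:
  assumes ind: "indep_vars (\<lambda>_. W) S I" and J: "J \<subseteq> I" and p: "p \<in> I" "p \<notin> J"
    and law: "distr M W (S p) = W"
  shows "fresh_seed (PiM J (\<lambda>_. W)) (\<lambda>\<omega>. \<lambda>j\<in>J. S j \<omega>) W (S p)"
proof -
  have S: "S p \<in> M \<rightarrow>\<^sub>M W" using ind p by (auto simp: indep_vars_def)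
  interpret W: prob_space W using prob_space_distr[OF S] law by simp
  let ?Z = "\<lambda>\<omega>. \<lambda>j\<in>J. S j \<omega>" and ?R = "\<lambda>\<omega>. \<lambda>j\<in>{p}. S j \<omega>"
  let ?N = "PiM J (\<lambda>_. W)" and ?P = "PiM {p} (\<lambda>_. W)"
  have "indep_var ?N ?Z ?P ?R"
    using p J by (intro indep_var_restrict[OF ind]) auto
  then have rv: "?Z \<in> M \<rightarrow>\<^sub>M ?N" "?R \<in> M \<rightarrow>\<^sub>M ?P"
    and eq: "distr M ?N ?Z \<Otimes>\<^sub>M distr M ?P ?R = distr M (?N \<Otimes>\<^sub>M ?P) (\<lambda>\<omega>. (?Z \<omega>, ?R \<omega>))"
    unfolding indep_var_distribution_eq by auto
  have [measurable]: "(\<lambda>h. h p) \<in> ?P \<rightarrow>\<^sub>M W" by (rule measurable_component_singleton) simp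
  have W: "distr (distr M ?P ?R) W (\<lambda>h. h p) = W"
    using rv law by (simp add: distr_distr comp_def)
  have "distr M ?N ?Z \<Otimes>\<^sub>M W = distr (distr M ?N ?Z) ?N (\<lambda>z. z) \<Otimes>\<^sub>M distr (distr M ?P ?R) W (\<lambda>h. h p)"
    using rv by (simp add: W distr_distr comp_def)
  also have "\<dots> = distr (distr M ?N ?Z \<Otimes>\<^sub>M distr M ?P ?R) (?N \<Otimes>\<^sub>M W) (\<lambda>(z, h). (z, h p))"
    using W.sigma_finite_measure_axioms by (intro pair_measure_distr) (auto simp: W)
  also have "\<dots> = distr M (?N \<Otimes>\<^sub>M W) (\<lambda>\<omega>. (?Z \<omega>, S p \<omega>))"
    unfolding eq using rv by (subst distr_distr) (auto simp: comp_def)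
  finally show ?thesis using rv S law by (auto simp: fresh_seed_def)
qed

text \<open>A fresh seed can be integrated out first, with the past frozen: the joint law is a product, so
  this is Tonelli's theorem. The same argument with Fubini's theorem gives \<open>integral_fresh\<close>, and for
  null sets \<open>AE_fresh\<close>. These replace conditioning on the past.\<close>

lemma nn_integral_fresh:
  assumes fresh: "fresh_seed N Z W s"
    and h: "h \<in> borel_measurable (N \<Otimes>\<^sub>M W)"
  shows "(\<integral>\<^sup>+\<omega>. h (Z \<omega>, s \<omega>) \<partial>M) = (\<integral>\<^sup>+\<omega>. (\<integral>\<^sup>+t. h (Z \<omega>, t) \<partial>W) \<partial>M)"
proof -
  interpret W: prob_space W by (rule fresh_seed_prob_space[OF fresh])
  have Z: "Z \<in> M \<rightarrow>\<^sub>M N" by (rule fresh_seed_rv1[OF fresh])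
  have "(\<integral>\<^sup>+\<omega>. h (Z \<omega>, s \<omega>) \<partial>M) = (\<integral>\<^sup>+y. h y \<partial>(distr M N Z \<Otimes>\<^sub>M W))"
    using h by (simp add: fresh_seed_joint_distr[OF fresh] nn_integral_distr fresh_seed_measurable[OF fresh])
  also have "\<dots> = (\<integral>\<^sup>+z. (\<integral>\<^sup>+t. h (z, t) \<partial>W) \<partial>distr M N Z)"
    using h by (simp add: W.nn_integral_fst)
  also have "\<dots> = (\<integral>\<^sup>+\<omega>. (\<integral>\<^sup>+t. h (Z \<omega>, t) \<partial>W) \<partial>M)"
    using Z h by (intro nn_integral_distr) (auto intro!: W.borel_measurable_nn_integral_fst)
  finally show ?thesis .
qed

lemma integral_fresh:
  fixes h :: "_ \<Rightarrow> real"
  assumes fresh: "fresh_seed N Z W s"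
    and h: "h \<in> borel_measurable (N \<Otimes>\<^sub>M W)" and int: "integrable M (\<lambda>\<omega>. h (Z \<omega>, s \<omega>))"
  shows "(\<integral>\<omega>. h (Z \<omega>, s \<omega>) \<partial>M) = (\<integral>\<omega>. (\<integral>t. h (Z \<omega>, t) \<partial>W) \<partial>M)"
proof -
  interpret W: prob_space W by (rule fresh_seed_prob_space[OF fresh])
  have Z: "Z \<in> M \<rightarrow>\<^sub>M N" by (rule fresh_seed_rv1[OF fresh])
  interpret Z: prob_space "distr M N Z" using Z by (rule prob_space_distr)
  interpret P: pair_sigma_finite "distr M N Z" W ..
  have "(\<integral>\<omega>. h (Z \<omega>, s \<omega>) \<partial>M) = (\<integral>y. h y \<partial>(distr M N Z \<Otimes>\<^sub>M W))"
    using h by (simp add: fresh_seed_joint_distr[OF fresh] integral_distr fresh_seed_measurable[OF fresh])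
  also have "\<dots> = (\<integral>z. (\<integral>t. h (z, t) \<partial>W) \<partial>distr M N Z)"
  proof (rule P.integral_fst'[symmetric])
    show "integrable (distr M N Z \<Otimes>\<^sub>M W) h"
      using h int unfolding fresh_seed_joint_distr[OF fresh]
      by (subst integrable_distr_eq) (auto intro: fresh_seed_measurable[OF fresh])
  qed
  also have "\<dots> = (\<integral>\<omega>. (\<integral>t. h (Z \<omega>, t) \<partial>W) \<partial>M)"
    using Z h by (intro integral_distr) (auto intro!: W.borel_measurable_lebesgue_integral)
  finally show ?thesis .
qed

lemma AE_fresh:
  assumes fresh: "fresh_seed N Z W s"
    and meas: "{y \<in> space (N \<Otimes>\<^sub>M W). P y} \<in> sets (N \<Otimes>\<^sub>M W)"
    and AE: "\<And>z. AE t in W. P (z, t)"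
  shows "AE \<omega> in M. P (Z \<omega>, s \<omega>)"
proof -
  interpret W: prob_space W by (rule fresh_seed_prob_space[OF fresh])
  have Z: "Z \<in> M \<rightarrow>\<^sub>M N" by (rule fresh_seed_rv1[OF fresh])
  interpret Z: prob_space "distr M N Z" using Z by (rule prob_space_distr)
  interpret P: pair_sigma_finite "distr M N Z" W ..
  have "AE y in distr M N Z \<Otimes>\<^sub>M W. P y"
    by (rule P.AE_pair_measure) (use meas AE in \<open>auto simp: space_pair_measure cong: sets_pair_measure_cong\<close>)
  then show ?thesis
    unfolding fresh_seed_joint_distr[OF fresh]
    by (subst (asm) AE_distr_iff) (use meas fresh_seed_measurable[OF fresh] in auto)
qed

end

section \<open>Unbiased random quantizers\<close>

text \<open>The variance of the quantization of a unit vector is nonnegative and at most \<alpha> - 1.\<close>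

lemma quantizer_variance_ge_1:
  fixes Q :: "'s \<Rightarrow> real ^ 'd \<Rightarrow> real ^ 'd"
  assumes "unbiased_random_quantizer W Q \<alpha>"
  shows "1 \<le> \<alpha>"
proof -
  obtain v :: "real ^ 'd" where v: "norm v = 1" using vector_choose_size[of 1] by auto
  interpret W: prob_space W using assms by (simp add: unbiased_random_quantizer_def)
  have Q: "integrable W (\<lambda>s. Q s v)" "(\<integral>s. Q s v \<partial>W) = v"
    "integrable W (\<lambda>s. (norm (Q s v))\<^sup>2)" "(\<integral>s. (norm (Q s v))\<^sup>2 \<partial>W) \<le> \<alpha> * (norm v)\<^sup>2"
    using assms by (auto simp: unbiased_random_quantizer_def)
  have "0 \<le> (\<integral>s. (norm (Q s v - v))\<^sup>2 \<partial>W)" by simp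
  also have "\<dots> = (\<integral>s. (norm (Q s v))\<^sup>2 - 2 * (Q s v \<bullet> v) + (norm v)\<^sup>2 \<partial>W)"
    by (simp add: power2_norm_eq_inner inner_diff_left inner_diff_right inner_commute algebra_simps)
  also have "\<dots> = (\<integral>s. (norm (Q s v))\<^sup>2 \<partial>W) - 2 * (v \<bullet> v) + (norm v)\<^sup>2"
    using Q by (simp add: W.prob_space)
  finally show ?thesis using Q(4) v by (simp add: flip: power2_norm_eq_inner)
qed

context prob_space
begin

lemma
  fixes Q :: "'s \<Rightarrow> real ^ 'd \<Rightarrow> real ^ 'd"
  assumes quantizer: "unbiased_random_quantizer W Q \<alpha>"
    and fresh: "fresh_seed borel Z W s"
    and Z: "square_integrable M Z"
  shows square_integrable_quantized: "square_integrable M (\<lambda>\<omega>. Q (s \<omega>) (Z \<omega>))"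
    and second_moment_quantized:
      "expectation (\<lambda>\<omega>. (norm (Q (s \<omega>) (Z \<omega>)))\<^sup>2) \<le> \<alpha> * expectation (\<lambda>\<omega>. (norm (Z \<omega>))\<^sup>2)"
proof -
  have \<alpha>: "0 < \<alpha>" using quantizer by (simp add: unbiased_random_quantizer_def)
  have [measurable]: "(\<lambda>(s, v). Q s v) \<in> borel_measurable (W \<Otimes>\<^sub>M borel)"
    using quantizer by (simp add: unbiased_random_quantizer_def)
  have [measurable]: "Z \<in> borel_measurable M" "s \<in> M \<rightarrow>\<^sub>M W"
    using fresh by (auto dest: fresh_seed_rv1 fresh_seed_rv2)
  have meas [measurable]: "(\<lambda>\<omega>. Q (s \<omega>) (Z \<omega>)) \<in> borel_measurable M" by measurable
  have inner: "(\<integral>\<^sup>+t. ennreal ((norm (Q t v))\<^sup>2) \<partial>W) \<le> ennreal (\<alpha> * (norm v)\<^sup>2)" for v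
    using quantizer by (subst nn_integral_eq_integral) (auto simp: unbiased_random_quantizer_def intro: ennreal_leI)
  have "(\<integral>\<^sup>+\<omega>. ennreal ((norm (Q (s \<omega>) (Z \<omega>)))\<^sup>2) \<partial>M)
      = (\<integral>\<^sup>+\<omega>. (\<integral>\<^sup>+t. ennreal ((norm (Q t (Z \<omega>)))\<^sup>2) \<partial>W) \<partial>M)"
    using nn_integral_fresh[OF fresh, of "\<lambda>(v, t). ennreal ((norm (Q t v))\<^sup>2)"] by simp
  also have "\<dots> \<le> (\<integral>\<^sup>+\<omega>. ennreal (\<alpha> * (norm (Z \<omega>))\<^sup>2) \<partial>M)"
    by (intro nn_integral_mono inner)
  also have "\<dots> = ennreal (\<alpha> * expectation (\<lambda>\<omega>. (norm (Z \<omega>))\<^sup>2))"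
    using \<alpha> square_integrableD[OF Z] by (subst nn_integral_eq_integral) auto
  finally have bound: "(\<integral>\<^sup>+\<omega>. ennreal ((norm (Q (s \<omega>) (Z \<omega>)))\<^sup>2) \<partial>M)
      \<le> ennreal (\<alpha> * expectation (\<lambda>\<omega>. (norm (Z \<omega>))\<^sup>2))" .
  then have int: "integrable M (\<lambda>\<omega>. (norm (Q (s \<omega>) (Z \<omega>)))\<^sup>2)"
    by (intro integrableI_nonneg) (auto simp: le_less_trans)
  with meas show "square_integrable M (\<lambda>\<omega>. Q (s \<omega>) (Z \<omega>))"
    by (simp add: square_integrable_def)
  from bound int \<alpha> show "expectation (\<lambda>\<omega>. (norm (Q (s \<omega>) (Z \<omega>)))\<^sup>2) \<le> \<alpha> * expectation (\<lambda>\<omega>. (norm (Z \<omega>))\<^sup>2)"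
    by (subst (asm) nn_integral_eq_integral) (auto simp: ennreal_le_iff)
qed

lemma expectation_inner_quantized:
  fixes Q :: "'s \<Rightarrow> real ^ 'd \<Rightarrow> real ^ 'd"
  assumes quantizer: "unbiased_random_quantizer W Q \<alpha>"
    and fresh: "fresh_seed (borel \<Otimes>\<^sub>M borel) (\<lambda>\<omega>. (Z \<omega>, Y \<omega>)) W s"
    and Z: "square_integrable M Z" and Y: "square_integrable M Y"
  shows "expectation (\<lambda>\<omega>. Q (s \<omega>) (Z \<omega>) \<bullet> Y \<omega>) = expectation (\<lambda>\<omega>. Z \<omega> \<bullet> Y \<omega>)"
proof -
  have [measurable]: "(\<lambda>(s, v). Q s v) \<in> borel_measurable (W \<Otimes>\<^sub>M borel)"
    using quantizer by (simp add: unbiased_random_quantizer_def)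
  have fresh1: "fresh_seed borel Z W s"
    using fresh_seed_compose[OF fresh measurable_fst] by simp
  have int: "integrable M (\<lambda>\<omega>. Q (s \<omega>) (Z \<omega>) \<bullet> Y \<omega>)"
    using square_integrable_quantized[OF quantizer fresh1 Z] Y by (rule square_integrable_inner)
  have "expectation (\<lambda>\<omega>. Q (s \<omega>) (Z \<omega>) \<bullet> Y \<omega>) = expectation (\<lambda>\<omega>. \<integral>t. Q t (Z \<omega>) \<bullet> Y \<omega> \<partial>W)"
    using integral_fresh[OF fresh, of "\<lambda>z. Q (snd z) (fst (fst z)) \<bullet> snd (fst z)"] int by simp
  also have "\<dots> = expectation (\<lambda>\<omega>. Z \<omega> \<bullet> Y \<omega>)"
    using quantizer by (simp add: unbiased_random_quantizer_def)
  finally show ?thesis .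
qed

end

section \<open>Moments of the iterates\<close>

text \<open>The point xstar is any centre from which errors are measured; that it is the minimizer enters
  through strong monotonicity of the total gradient around it, stated where it is used.\<close>

locale quantized_delayed_gradient = prob_space M
  for M :: "'w measure" +
  fixes W :: "'s measure" and Q :: "'s \<Rightarrow> real ^ 'd \<Rightarrow> real ^ 'd"
    and \<xi> :: "nat \<Rightarrow> nat \<Rightarrow> 'w \<Rightarrow> 's" and g :: "nat \<Rightarrow> real ^ 'd \<Rightarrow> real ^ 'd"
    and a :: "nat \<Rightarrow> real ^ 'd" and m \<tau> :: nat and delay :: "nat \<Rightarrow> nat \<Rightarrow> nat"
    and L \<alpha> \<gamma> :: real and x0 xstar :: "real ^ 'd" and x :: "int \<Rightarrow> 'w \<Rightarrow> real ^ 'd"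
  assumes m: "1 \<le> m"
    and quantizer: "unbiased_random_quantizer W Q \<alpha>"
    and seeds: "fresh_seeds M W m \<xi>"
    and iterates: "quantized_delayed_iterates M Q \<xi> m g delay \<gamma> x0 x"
    and delay_le: "i \<in> {1..m} \<Longrightarrow> delay k i \<le> \<tau>"
    and lipschitz: "i \<in> {1..m} \<Longrightarrow> L-lipschitz_on UNIV (g i)"
    and support: "i \<in> {1..m} \<Longrightarrow> vsupp (g i y) = vsupp (a i)"
begin

text \<open>The iterates are reindexed by natural numbers. As they are constant up to index 0, truncated
  subtraction k - delay k i yields the right stale iterate even when the delay exceeds k.\<close>

definition X :: "nat \<Rightarrow> 'w \<Rightarrow> real ^ 'd" where
  "X n = x (int n)"

definition stale_gradient :: "nat \<Rightarrow> nat \<Rightarrow> 'w \<Rightarrow> real ^ 'd" where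
  "stale_gradient k i \<omega> = g i (X (k - delay k i) \<omega>)"

definition quantized_step :: "nat \<Rightarrow> 'w \<Rightarrow> real ^ 'd" where
  "quantized_step k \<omega> = (\<Sum>i=1..m. Q (\<xi> k i \<omega>) (stale_gradient k i \<omega>))"

definition error :: "nat \<Rightarrow> real" where
  "error k = expectation (\<lambda>\<omega>. (norm (X k \<omega> - xstar))\<^sup>2)"

definition gradient_noise :: real where
  "gradient_noise = (\<Sum>i=1..m. (norm (g i xstar))\<^sup>2)"

lemma X_0: "\<omega> \<in> space M \<Longrightarrow> X 0 \<omega> = x0"
  using iterates by (simp add: X_def quantized_delayed_iterates_def)

lemma X_Suc:
  assumes "\<omega> \<in> space M"
  shows "X (Suc k) \<omega> = X k \<omega> - \<gamma> *\<^sub>R quantized_step k \<omega>"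
proof -
  have "x (int k - int (delay k i)) \<omega> = X (k - delay k i) \<omega>" for i
    using iterates assms
    by (cases "delay k i \<le> k") (auto simp: X_def of_nat_diff quantized_delayed_iterates_def)
  then show ?thesis
    using iterates assms
    by (simp add: X_def quantized_step_def stale_gradient_def quantized_delayed_iterates_def add.commute)
qed

text \<open>Unrolling the recursion writes the iterates up to time k as measurable functions of the seeds
  drawn before time k. This is what makes the seeds of time k fresh with respect to them.\<close>

lemma X_depends_on_past_seeds:
  assumes "n \<le> k"
  shows "\<exists>\<phi>\<in>borel_measurable (PiM ({..<k} \<times> {1..m}) (\<lambda>_. W)).
    \<forall>\<omega>\<in>space M. X n \<omega> = \<phi> (\<lambda>p\<in>{..<k} \<times> {1..m}. (case p of (k, i) \<Rightarrow> \<xi> k i) \<omega>)"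
  using assms
proof (induction n rule: less_induct)
  case (less n)
  let ?N = "PiM ({..<k} \<times> {1..m}) (\<lambda>_. W)"
  let ?R = "\<lambda>\<omega>. \<lambda>p\<in>{..<k} \<times> {1..m}. (case p of (k, i) \<Rightarrow> \<xi> k i) \<omega>"
  have "\<forall>l. \<exists>\<phi>. l < n \<longrightarrow> \<phi> \<in> borel_measurable ?N \<and> (\<forall>\<omega>\<in>space M. X l \<omega> = \<phi> (?R \<omega>))"
    using less by (meson less_imp_le_nat order_trans)
  then obtain \<phi> where \<phi>: "\<And>l. l < n \<Longrightarrow> \<phi> l \<in> borel_measurable ?N"
    "\<And>l \<omega>. l < n \<Longrightarrow> \<omega> \<in> space M \<Longrightarrow> X l \<omega> = \<phi> l (?R \<omega>)"
    by metis
  show ?case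
  proof (cases n)
    case 0
    then show ?thesis by (intro bexI[of _ "\<lambda>_. x0"]) (auto simp: X_0)
  next
    case (Suc n')
    have [measurable]: "(\<lambda>(s, v). Q s v) \<in> borel_measurable (W \<Otimes>\<^sub>M borel)"
      using quantizer by (simp add: unbiased_random_quantizer_def)
    let ?\<psi> = "\<lambda>h. \<phi> n' h - \<gamma> *\<^sub>R (\<Sum>i=1..m. Q (h (n', i)) (g i (\<phi> (n' - delay n' i) h)))"
    have "(\<lambda>h. Q (h (n', i)) (g i (\<phi> (n' - delay n' i) h))) \<in> borel_measurable ?N"
      if i: "i \<in> {1..m}" for i
    proof -
      have [measurable]: "g i \<in> borel_measurable borel"
        using lipschitz[OF i] by (intro borel_measurable_continuous_onI lipschitz_on_continuous_on)
      have [measurable]: "\<phi> (n' - delay n' i) \<in> borel_measurable ?N" using Suc by (intro \<phi>) simp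
      have [measurable]: "(\<lambda>h. h (n', i)) \<in> ?N \<rightarrow>\<^sub>M W"
        using i less.prems Suc by (intro measurable_component_singleton) auto
      show ?thesis by measurable
    qed
    then have meas: "?\<psi> \<in> borel_measurable ?N"
      using \<phi>(1)[of n'] Suc by (intro borel_measurable_diff borel_measurable_scaleR borel_measurable_sum) auto
    have eq: "X n \<omega> = ?\<psi> (?R \<omega>)" if "\<omega> \<in> space M" for \<omega>
      using that less.prems Suc
      by (auto simp: X_Suc \<phi>(2) quantized_step_def stale_gradient_def intro!: sum.cong)
    show ?thesis by (intro bexI[where x="?\<psi>"] ballI meas eq)
  qed
qed

text \<open>Two iterates are needed at once: the inner product of a quantized stale gradient with the
  current iterate involves both.\<close>

lemma current_seed_fresh:
  assumes "n \<le> k" "n' \<le> k" and i: "i \<in> {1..m}"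
  shows "fresh_seed (borel \<Otimes>\<^sub>M borel) (\<lambda>\<omega>. (X n \<omega>, X n' \<omega>)) W (\<xi> k i)"
proof -
  let ?N = "PiM ({..<k} \<times> {1..m}) (\<lambda>_. W)"
  let ?R = "\<lambda>\<omega>. \<lambda>p\<in>{..<k} \<times> {1..m}. (case p of (k, i) \<Rightarrow> \<xi> k i) \<omega>"
  obtain \<phi> \<phi>' where \<phi> [measurable]: "\<phi> \<in> borel_measurable ?N" "\<phi>' \<in> borel_measurable ?N"
    and eq: "\<And>\<omega>. \<omega> \<in> space M \<Longrightarrow> X n \<omega> = \<phi> (?R \<omega>)" "\<And>\<omega>. \<omega> \<in> space M \<Longrightarrow> X n' \<omega> = \<phi>' (?R \<omega>)"
    using X_depends_on_past_seeds[OF assms(1)] X_depends_on_past_seeds[OF assms(2)] by blast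
  have "fresh_seed ?N ?R W (case (k, i) of (k, i) \<Rightarrow> \<xi> k i)"
    using seeds i unfolding fresh_seeds_def
    by (intro indep_vars_fresh_seed[where I="UNIV \<times> {1..m}"]) (auto simp: split_def)
  then have "fresh_seed ?N ?R W (\<xi> k i)" unfolding prod.case .
  from fresh_seed_compose[OF this measurable_Pair[OF \<phi>]]
  show ?thesis by (rule fresh_seed_cong) (simp_all only: eq)
qed

lemma stale_gradient_seed_fresh:
  assumes i: "i \<in> {1..m}"
  shows "fresh_seed (borel \<Otimes>\<^sub>M borel) (\<lambda>\<omega>. (stale_gradient k i \<omega>, X k \<omega> - c)) W (\<xi> k i)"
proof -
  have [measurable]: "g i \<in> borel_measurable borel"
    using lipschitz[OF i] by (intro borel_measurable_continuous_onI lipschitz_on_continuous_on)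
  show ?thesis
    using fresh_seed_compose[OF current_seed_fresh[of "k - delay k i" k k i],
        of "\<lambda>(u, v). (g i u, v - c)" "borel \<Otimes>\<^sub>M borel"] i
    by (simp add: stale_gradient_def split_def)
qed

lemma stale_gradient_fresh:
  "i \<in> {1..m} \<Longrightarrow> fresh_seed borel (stale_gradient k i) W (\<xi> k i)"
  using fresh_seed_compose[OF stale_gradient_seed_fresh measurable_fst] by simp

text \<open>Quantization almost surely adds no coordinate to the support of the stale gradient, which is that
  of the data vector. Hence the quantized gradients of one step still conflict only along the conflict graph.\<close>

lemma AE_quantized_support:
  "AE \<omega> in M. \<forall>i\<in>{1..m}. vsupp (Q (\<xi> k i \<omega>) (stale_gradient k i \<omega>)) \<subseteq> vsupp (a i)"
proof (intro AE_ball_countable[THEN iffD2] ballI)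
  fix i assume i: "i \<in> {1..m}"
  have [measurable]: "(\<lambda>(s, v). Q s v) \<in> borel_measurable (W \<Otimes>\<^sub>M borel)"
    using quantizer by (simp add: unbiased_random_quantizer_def)
  have [measurable]: "(\<lambda>v :: real ^ 'd. v $ j) \<in> borel_measurable borel" for j
    by (intro borel_measurable_continuous_onI continuous_intros)
  have "AE \<omega> in M. (\<lambda>(v, s). vsupp (Q s v) \<subseteq> vsupp v) (stale_gradient k i \<omega>, \<xi> k i \<omega>)"
  proof (rule AE_fresh[OF stale_gradient_fresh[OF i]])
    have "{y \<in> space (borel \<Otimes>\<^sub>M W). \<forall>j. fst y $ j = 0 \<longrightarrow> Q (snd y) (fst y) $ j = 0}
        \<in> sets (borel \<Otimes>\<^sub>M W)"
      by measurable
    then show "{y \<in> space (borel \<Otimes>\<^sub>M W). case y of (v, s) \<Rightarrow> vsupp (Q s v) \<subseteq> vsupp v}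
        \<in> sets (borel \<Otimes>\<^sub>M W)"
      by (rule back_subst[of "\<lambda>A. A \<in> sets _"]) (auto simp: vsupp_def)
    show "AE s in W. case (v, s) of (v, s) \<Rightarrow> vsupp (Q s v) \<subseteq> vsupp v" for v
      using quantizer by (simp add: unbiased_random_quantizer_def)
  qed
  then show "AE \<omega> in M. vsupp (Q (\<xi> k i \<omega>) (stale_gradient k i \<omega>)) \<subseteq> vsupp (a i)"
    using support[OF i] by (simp add: stale_gradient_def)
qed simp

lemma square_integrable_X: "square_integrable M (X n)"
proof (induction n rule: less_induct)
  case (less n)
  show ?case
  proof (cases n)
    case 0
    have "square_integrable M (\<lambda>_. x0)" by (rule square_integrable_const)
    then show ?thesis by (rule square_integrable_cong) (simp add: 0 X_0)
  next
    case (Suc k)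
    have "square_integrable M (stale_gradient k i)" if "i \<in> {1..m}" for i
      unfolding stale_gradient_def[abs_def]
      by (rule square_integrable_lipschitz[OF lipschitz[OF that]]) (use less Suc in simp)
    then have "square_integrable M (\<lambda>\<omega>. Q (\<xi> k i \<omega>) (stale_gradient k i \<omega>))" if "i \<in> {1..m}" for i
      using square_integrable_quantized[OF quantizer stale_gradient_fresh] that by blast
    then have "square_integrable M (\<lambda>\<omega>. X k \<omega> - \<gamma> *\<^sub>R quantized_step k \<omega>)"
      unfolding quantized_step_def using less[of k] Suc
      by (intro square_integrable_diff square_integrable_scaleR square_integrable_sum) auto
    then show ?thesis by (rule square_integrable_cong) (simp add: Suc X_Suc)
  qed
qed

lemma square_integrable_error: "square_integrable M (\<lambda>\<omega>. X n \<omega> - c)"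
  by (intro square_integrable_diff square_integrable_X square_integrable_const)

lemma square_integrable_stale_gradient:
  "i \<in> {1..m} \<Longrightarrow> square_integrable M (stale_gradient k i)"
  unfolding stale_gradient_def[abs_def]
  by (intro square_integrable_lipschitz[OF lipschitz] square_integrable_X)

lemma square_integrable_quantized_gradient:
  "i \<in> {1..m} \<Longrightarrow> square_integrable M (\<lambda>\<omega>. Q (\<xi> k i \<omega>) (stale_gradient k i \<omega>))"
  by (intro square_integrable_quantized[OF quantizer stale_gradient_fresh] square_integrable_stale_gradient)

lemma square_integrable_quantized_step: "square_integrable M (quantized_step k)"
  unfolding quantized_step_def[abs_def]
  by (intro square_integrable_sum square_integrable_quantized_gradient)

lemma error_nonneg: "0 \<le> error k"
  by (simp add: error_def)

lemma gradient_noise_nonneg: "0 \<le> gradient_noise"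
  by (simp add: gradient_noise_def sum_nonneg)

lemma L_nonneg: "0 \<le> L"
  using lipschitz[of 1] m by (auto intro: lipschitz_on_nonneg)

lemma quantizer_variance_nonneg: "0 \<le> \<alpha>"
  using quantizer_variance_ge_1[OF quantizer] by simp

lemma lipschitz_norm: "i \<in> {1..m} \<Longrightarrow> norm (g i y - g i z) \<le> L * norm (y - z)"
  using lipschitz_onD[OF lipschitz, of i y z] by (simp add: dist_norm)

lemma vsupp_gradient_diff:
  assumes "i \<in> {1..m}"
  shows "vsupp (g i u - g i v) \<subseteq> vsupp (a i)"
proof -
  have "g i w $ j = 0" if "a i $ j = 0" for w j
    using support[OF assms, of w] that by (auto simp: vsupp_def set_eq_iff)
  then show ?thesis by (auto simp: vsupp_def)
qed

lemma stale_gradient_second_moment: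
  assumes i: "i \<in> {1..m}" and t: "0 < t"
  shows "expectation (\<lambda>\<omega>. (norm (stale_gradient k i \<omega>))\<^sup>2)
    \<le> (1 + t) * L\<^sup>2 * error (k - delay k i) + (1 + 1 / t) * (norm (g i xstar))\<^sup>2"
proof -
  let ?Y = "\<lambda>\<omega>. X (k - delay k i) \<omega> - xstar"
  have le: "(norm (stale_gradient k i \<omega>))\<^sup>2
      \<le> (1 + t) * L\<^sup>2 * (norm (?Y \<omega>))\<^sup>2 + (1 + 1 / t) * (norm (g i xstar))\<^sup>2" for \<omega>
  proof -
    have "(norm (g i (X (k - delay k i) \<omega>) - g i xstar))\<^sup>2 \<le> L\<^sup>2 * (norm (?Y \<omega>))\<^sup>2"
      using power_mono[OF lipschitz_norm[OF i] norm_ge_zero] by (simp add: power_mult_distrib)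
    then have "(1 + t) * (norm (g i (X (k - delay k i) \<omega>) - g i xstar))\<^sup>2
        \<le> (1 + t) * (L\<^sup>2 * (norm (?Y \<omega>))\<^sup>2)"
      using t by (intro mult_left_mono) auto
    with norm_add_squared_le[OF t, of "stale_gradient k i \<omega> - g i xstar" "g i xstar"] show ?thesis
      by (simp add: stale_gradient_def)
  qed
  have "expectation (\<lambda>\<omega>. (norm (stale_gradient k i \<omega>))\<^sup>2)
      \<le> expectation (\<lambda>\<omega>. (1 + t) * L\<^sup>2 * (norm (?Y \<omega>))\<^sup>2 + (1 + 1 / t) * (norm (g i xstar))\<^sup>2)"
    using square_integrableD(2)[OF square_integrable_error] square_integrableD(2)[OF square_integrable_stale_gradient[OF i]]
    by (intro integral_mono le) auto
  also have "\<dots> = (1 + t) * L\<^sup>2 * error (k - delay k i) + (1 + 1 / t) * (norm (g i xstar))\<^sup>2"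
    using square_integrableD(2)[OF square_integrable_error] by (simp add: error_def prob_space)
  finally show ?thesis .
qed

text \<open>The conflict factor replaces the factor m that the crude inequality
  \<open>\<parallel>\<Sum>v\<^sub>i\<parallel>\<^sup>2 \<le> m \<Sum>\<parallel>v\<^sub>i\<parallel>\<^sup>2\<close> would give. Quantization then costs \<alpha>, and each stale gradient is split into
  its deviation from the gradient at xstar, of size L times a past error, and that gradient.\<close>

lemma quantized_step_second_moment:
  assumes t: "0 < t" and B: "\<And>l. l \<le> k \<Longrightarrow> k \<le> l + \<tau> \<Longrightarrow> error l \<le> B"
  shows "expectation (\<lambda>\<omega>. (norm (quantized_step k \<omega>))\<^sup>2)
    \<le> conflict_factor m a * \<alpha> * ((1 + t) * real m * L\<^sup>2 * B + (1 + 1 / t) * gradient_noise)"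
proof -
  let ?q = "\<lambda>i \<omega>. Q (\<xi> k i \<omega>) (stale_gradient k i \<omega>)"
  have int: "integrable M (\<lambda>\<omega>. (norm (?q i \<omega>))\<^sup>2)" if "i \<in> {1..m}" for i
    by (intro square_integrableD(2) square_integrable_quantized_gradient that)
  have "expectation (\<lambda>\<omega>. (norm (quantized_step k \<omega>))\<^sup>2)
      \<le> expectation (\<lambda>\<omega>. conflict_factor m a * (\<Sum>i=1..m. (norm (?q i \<omega>))\<^sup>2))"
  proof (rule integral_mono_AE)
    show "AE \<omega> in M. (norm (quantized_step k \<omega>))\<^sup>2
        \<le> conflict_factor m a * (\<Sum>i=1..m. (norm (?q i \<omega>))\<^sup>2)"
      using AE_quantized_support[of k] unfolding quantized_step_def
      by eventually_elim (intro norm_sum_le_conflict_factor m, auto)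
  qed (use int square_integrableD(2)[OF square_integrable_quantized_step] in auto)
  also have "\<dots> = conflict_factor m a * (\<Sum>i=1..m. expectation (\<lambda>\<omega>. (norm (?q i \<omega>))\<^sup>2))"
    using int by simp
  also have "\<dots> \<le> conflict_factor m a *
      (\<Sum>i=1..m. \<alpha> * ((1 + t) * L\<^sup>2 * B + (1 + 1 / t) * (norm (g i xstar))\<^sup>2))"
  proof (intro mult_left_mono sum_mono conflict_factor_nonneg)
    fix i assume i: "i \<in> {1..m}"
    have "expectation (\<lambda>\<omega>. (norm (?q i \<omega>))\<^sup>2) \<le> \<alpha> * expectation (\<lambda>\<omega>. (norm (stale_gradient k i \<omega>))\<^sup>2)"
      by (rule second_moment_quantized[OF quantizer stale_gradient_fresh[OF i]
            square_integrable_stale_gradient[OF i]])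
    also have "\<dots> \<le> \<alpha> * ((1 + t) * L\<^sup>2 * error (k - delay k i) + (1 + 1 / t) * (norm (g i xstar))\<^sup>2)"
      by (intro mult_left_mono stale_gradient_second_moment i t quantizer_variance_nonneg)
    also have "\<dots> \<le> \<alpha> * ((1 + t) * L\<^sup>2 * B + (1 + 1 / t) * (norm (g i xstar))\<^sup>2)"
      using t delay_le[OF i, of k]
      by (intro mult_left_mono add_right_mono B quantizer_variance_nonneg) auto
    finally show "expectation (\<lambda>\<omega>. (norm (?q i \<omega>))\<^sup>2)
      \<le> \<alpha> * ((1 + t) * L\<^sup>2 * B + (1 + 1 / t) * (norm (g i xstar))\<^sup>2)" .
  qed
  also have "\<dots> = conflict_factor m a * \<alpha> * ((1 + t) * real m * L\<^sup>2 * B + (1 + 1 / t) * gradient_noise)"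
  proof -
    have "(\<Sum>i=1..m. \<alpha> * (A + c * (norm (g i xstar))\<^sup>2)) = \<alpha> * (real m * A + c * gradient_noise)" for A c
      by (simp add: gradient_noise_def sum.distrib flip: sum_distrib_left)
    then show ?thesis by (simp only: mult_ac)
  qed
  finally show ?thesis .
qed

lemma X_diff:
  assumes "l \<le> k" "\<omega> \<in> space M"
  shows "X l \<omega> - X k \<omega> = \<gamma> *\<^sub>R (\<Sum>j=l..<k. quantized_step j \<omega>)"
  using assms(1)
proof (induction k rule: dec_induct)
  case (step n)
  then show ?case by (simp add: X_Suc[OF assms(2)] scaleR_add_right algebra_simps)
qed simp

text \<open>Every stale iterate differs from the current one by steps taken in the last \<tau> rounds, so one
  and the same bound holds for all summands and the number of conflicting pairs comes in. For
  summands with a common bound, counting pairs is the sharper estimate: the conflict factor would give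
  \<open>\<sigma> m\<close> in place of \<open>m (1 + \<Delta>)\<close>.\<close>

lemma stale_gradient_sum_error:
  assumes \<omega>: "\<omega> \<in> space M" and \<gamma>: "0 \<le> \<gamma>"
  shows "(norm ((\<Sum>i=1..m. stale_gradient k i \<omega>) - (\<Sum>i=1..m. g i (X k \<omega>))))\<^sup>2
    \<le> real (card (conflict_pairs m a)) * L\<^sup>2 * \<gamma>\<^sup>2 * real \<tau> *
      (\<Sum>j=k-\<tau>..<k. (norm (quantized_step j \<omega>))\<^sup>2)"
proof -
  let ?v = "\<lambda>i. stale_gradient k i \<omega> - g i (X k \<omega>)"
  let ?D = "\<Sum>j=k-\<tau>..<k. norm (quantized_step j \<omega>)"
  have v: "norm (?v i) \<le> L * (\<gamma> * ?D)" if i: "i \<in> {1..m}" for i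
  proof -
    have "norm (X (k - delay k i) \<omega> - X k \<omega>)
        = \<gamma> * norm (\<Sum>j=k-delay k i..<k. quantized_step j \<omega>)"
      using \<gamma> by (simp add: X_diff \<omega>)
    also have "\<dots> \<le> \<gamma> * (\<Sum>j=k-delay k i..<k. norm (quantized_step j \<omega>))"
      using \<gamma> by (intro mult_left_mono norm_sum)
    also have "\<dots> \<le> \<gamma> * ?D"
      using \<gamma> delay_le[OF i, of k] by (intro mult_left_mono sum_mono2) auto
    finally have "L * norm (X (k - delay k i) \<omega> - X k \<omega>) \<le> L * (\<gamma> * ?D)"
      by (intro mult_left_mono L_nonneg)
    with lipschitz_norm[OF i] show ?thesis unfolding stale_gradient_def by (rule order_trans)
  qed
  have "(norm (\<Sum>i=1..m. ?v i))\<^sup>2 \<le> real (card (conflict_pairs m a)) * (L * (\<gamma> * ?D))\<^sup>2"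
  proof (intro norm_sum_le_card_conflict_pairs v)
    show "vsupp (?v i) \<subseteq> vsupp (a i)" if "i \<in> {1..m}" for i
      unfolding stale_gradient_def using that by (rule vsupp_gradient_diff)
  qed
  also have "\<dots> = real (card (conflict_pairs m a)) * L\<^sup>2 * \<gamma>\<^sup>2 * ?D\<^sup>2"
    by (simp add: power_mult_distrib)
  also have "\<dots> \<le> real (card (conflict_pairs m a)) * L\<^sup>2 * \<gamma>\<^sup>2 *
      (real \<tau> * (\<Sum>j=k-\<tau>..<k. (norm (quantized_step j \<omega>))\<^sup>2))"
  proof (rule mult_left_mono)
    have "?D\<^sup>2 \<le> (\<Sum>j=k-\<tau>..<k. (norm (quantized_step j \<omega>))\<^sup>2) * real (card {k-\<tau>..<k})"
      by (rule sum_squared_le_sum_of_squares)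
    also have "\<dots> \<le> (\<Sum>j=k-\<tau>..<k. (norm (quantized_step j \<omega>))\<^sup>2) * real \<tau>"
      by (intro mult_left_mono sum_nonneg) auto
    finally show "?D\<^sup>2 \<le> real \<tau> * (\<Sum>j=k-\<tau>..<k. (norm (quantized_step j \<omega>))\<^sup>2)"
      by (simp add: mult.commute)
  qed simp
  finally show ?thesis by (simp add: sum_subtractf mult.assoc)
qed

text \<open>The steps of the last \<tau> rounds use gradients that are themselves up to \<tau> rounds old, which is
  why the errors of the last 2 \<tau> rounds enter.\<close>

lemma expected_stale_gradient_sum_error:
  assumes \<gamma>: "0 \<le> \<gamma>" and B: "\<And>l. l \<le> k \<Longrightarrow> k \<le> l + 2 * \<tau> \<Longrightarrow> error l \<le> B"
  shows "expectation (\<lambda>\<omega>. (norm ((\<Sum>i=1..m. stale_gradient k i \<omega>) - (\<Sum>i=1..m. g i (X k \<omega>))))\<^sup>2)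
    \<le> real (card (conflict_pairs m a)) * L\<^sup>2 * \<gamma>\<^sup>2 * (real \<tau>)\<^sup>2 *
      (conflict_factor m a * \<alpha> * (2 * real m * L\<^sup>2 * B + 2 * gradient_noise))"
proof -
  let ?K = "conflict_factor m a * \<alpha> * (2 * real m * L\<^sup>2 * B + 2 * gradient_noise)"
  let ?c = "real (card (conflict_pairs m a)) * L\<^sup>2 * \<gamma>\<^sup>2 * real \<tau>"
  have B0: "0 \<le> B" using B[of k] error_nonneg[of k] by simp
  have K: "0 \<le> ?K"
    using B0 by (intro mult_nonneg_nonneg add_nonneg_nonneg conflict_factor_nonneg
        quantizer_variance_nonneg gradient_noise_nonneg) auto
  note int = square_integrableD(2)[OF square_integrable_quantized_step]
  have "expectation (\<lambda>\<omega>. (norm ((\<Sum>i=1..m. stale_gradient k i \<omega>) - (\<Sum>i=1..m. g i (X k \<omega>))))\<^sup>2)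
      \<le> expectation (\<lambda>\<omega>. ?c * (\<Sum>j=k-\<tau>..<k. (norm (quantized_step j \<omega>))\<^sup>2))"
    using int \<gamma>
    by (intro integral_mono stale_gradient_sum_error square_integrableD(2) square_integrable_diff
        square_integrable_sum square_integrable_stale_gradient
        square_integrable_lipschitz[OF lipschitz] square_integrable_X) auto
  also have "\<dots> = ?c * (\<Sum>j=k-\<tau>..<k. expectation (\<lambda>\<omega>. (norm (quantized_step j \<omega>))\<^sup>2))"
    using int by simp
  also have "\<dots> \<le> ?c * (\<Sum>j=k-\<tau>..<k. ?K)"
  proof (intro mult_left_mono sum_mono)
    fix j assume j: "j \<in> {k-\<tau>..<k}"
    have "error l \<le> B" if "l \<le> j" "j \<le> l + \<tau>" for l using that j by (intro B) auto
    from quantized_step_second_moment[OF zero_less_one this]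
    show "expectation (\<lambda>\<omega>. (norm (quantized_step j \<omega>))\<^sup>2) \<le> ?K" by simp
  qed auto
  also have "\<dots> \<le> ?c * (real \<tau> * ?K)"
    using K by (intro mult_left_mono) (auto intro!: mult_right_mono)
  finally show ?thesis by (simp add: power2_eq_square mult_ac)
qed

text \<open>The quantizer is unbiased, so the quantized gradients may be replaced by the stale ones in the
  cross term, but not in the second moment.\<close>

lemma error_Suc:
  "error (Suc k) = error k
    - 2 * \<gamma> * expectation (\<lambda>\<omega>. (\<Sum>i=1..m. stale_gradient k i \<omega>) \<bullet> (X k \<omega> - xstar))
    + \<gamma>\<^sup>2 * expectation (\<lambda>\<omega>. (norm (quantized_step k \<omega>))\<^sup>2)"
proof -
  let ?Y = "\<lambda>\<omega>. X k \<omega> - xstar"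
  note Y = square_integrable_error[of k xstar]
  note intq = square_integrable_inner[OF square_integrable_quantized_gradient Y]
  note ints = square_integrable_inner[OF square_integrable_stale_gradient Y]
  have "expectation (\<lambda>\<omega>. quantized_step k \<omega> \<bullet> ?Y \<omega>)
      = (\<Sum>i=1..m. expectation (\<lambda>\<omega>. Q (\<xi> k i \<omega>) (stale_gradient k i \<omega>) \<bullet> ?Y \<omega>))"
    unfolding quantized_step_def inner_sum_left using intq by (intro Bochner_Integration.integral_sum) auto
  also have "\<dots> = (\<Sum>i=1..m. expectation (\<lambda>\<omega>. stale_gradient k i \<omega> \<bullet> ?Y \<omega>))"
    by (intro sum.cong refl expectation_inner_quantized[OF quantizer stale_gradient_seed_fresh]
        square_integrable_stale_gradient Y)
  also have "\<dots> = expectation (\<lambda>\<omega>. (\<Sum>i=1..m. stale_gradient k i \<omega>) \<bullet> ?Y \<omega>)"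
    unfolding inner_sum_left using ints by (intro Bochner_Integration.integral_sum[symmetric]) auto
  finally have cross: "expectation (\<lambda>\<omega>. quantized_step k \<omega> \<bullet> ?Y \<omega>) = \<dots>" .
  have "error (Suc k) = expectation (\<lambda>\<omega>. (norm (?Y \<omega>))\<^sup>2 - 2 * \<gamma> * (quantized_step k \<omega> \<bullet> ?Y \<omega>)
      + \<gamma>\<^sup>2 * (norm (quantized_step k \<omega>))\<^sup>2)"
    unfolding error_def
  proof (intro Bochner_Integration.integral_cong refl)
    fix \<omega> assume "\<omega> \<in> space M"
    have expand: "(norm (y - \<gamma> *\<^sub>R v))\<^sup>2 = (norm y)\<^sup>2 - 2 * \<gamma> * (v \<bullet> y) + \<gamma>\<^sup>2 * (norm v)\<^sup>2"
      for y v :: "real ^ 'd"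
      by (simp add: power2_norm_eq_inner inner_diff_left inner_diff_right inner_commute
          algebra_simps) (simp add: power2_eq_square)
    from \<open>\<omega> \<in> space M\<close> have eq: "X (Suc k) \<omega> - xstar = ?Y \<omega> - \<gamma> *\<^sub>R quantized_step k \<omega>" by (simp add: X_Suc)
    show "(norm (X (Suc k) \<omega> - xstar))\<^sup>2 = (norm (?Y \<omega>))\<^sup>2 - 2 * \<gamma> * (quantized_step k \<omega> \<bullet> ?Y \<omega>)
      + \<gamma>\<^sup>2 * (norm (quantized_step k \<omega>))\<^sup>2"
      unfolding eq by (rule expand)
  qed
  also have "\<dots> = error k - 2 * \<gamma> * expectation (\<lambda>\<omega>. quantized_step k \<omega> \<bullet> ?Y \<omega>)
      + \<gamma>\<^sup>2 * expectation (\<lambda>\<omega>. (norm (quantized_step k \<omega>))\<^sup>2)"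
    unfolding error_def
    using square_integrableD(2)[OF Y] square_integrableD(2)[OF square_integrable_quantized_step[of k]]
      square_integrable_inner[OF square_integrable_quantized_step Y]
    by simp
  finally show ?thesis unfolding cross .
qed

text \<open>In the cross term the stale gradients are compared with the gradient at the current iterate, to
  which strong monotonicity applies; the remainder is split by Young's inequality with weight c.\<close>

lemma one_step_bound:
  assumes \<gamma>: "0 \<le> \<gamma>" and t: "0 < t" and c: "0 < c"
    and monotone: "\<And>y. \<mu> * (norm (y - xstar))\<^sup>2 \<le> (\<Sum>i=1..m. g i y) \<bullet> (y - xstar)"
    and B: "\<And>l. l \<le> k \<Longrightarrow> k \<le> l + 2 * \<tau> \<Longrightarrow> error l \<le> B"
  shows "error (Suc k) \<le> (1 - 2 * \<mu> * \<gamma> + c * \<gamma>\<^sup>2) * error k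
    + (1 / c) * (real (card (conflict_pairs m a)) * L\<^sup>2 * \<gamma>\<^sup>2 * (real \<tau>)\<^sup>2 *
      (conflict_factor m a * \<alpha> * (2 * real m * L\<^sup>2 * B + 2 * gradient_noise)))
    + \<gamma>\<^sup>2 * (conflict_factor m a * \<alpha> * ((1 + t) * real m * L\<^sup>2 * B + (1 + 1 / t) * gradient_noise))"
proof -
  let ?Y = "\<lambda>\<omega>. X k \<omega> - xstar"
  let ?S = "\<lambda>\<omega>. \<Sum>i=1..m. stale_gradient k i \<omega>" and ?G = "\<lambda>\<omega>. \<Sum>i=1..m. g i (X k \<omega>)"
  have sqS: "square_integrable M ?S"
    by (intro square_integrable_sum square_integrable_stale_gradient)
  have sqD: "square_integrable M (\<lambda>\<omega>. ?S \<omega> - ?G \<omega>)"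
    by (intro square_integrable_diff sqS square_integrable_sum
        square_integrable_lipschitz[OF lipschitz] square_integrable_X)
  note Y = square_integrable_error[of k xstar]
  have "- (2 * \<gamma>) * (?S \<omega> \<bullet> ?Y \<omega>)
      \<le> (c * \<gamma>\<^sup>2 - 2 * \<mu> * \<gamma>) * (norm (?Y \<omega>))\<^sup>2 + (1 / c) * (norm (?S \<omega> - ?G \<omega>))\<^sup>2" for \<omega>
  proof -
    have "2 * ((- \<gamma>) *\<^sub>R ?Y \<omega> \<bullet> (?S \<omega> - ?G \<omega>))
        \<le> c * (norm ((- \<gamma>) *\<^sub>R ?Y \<omega>))\<^sup>2 + (1 / c) * (norm (?S \<omega> - ?G \<omega>))\<^sup>2"
      using c by (rule two_inner_le)
    moreover have "2 * \<gamma> * (\<mu> * (norm (?Y \<omega>))\<^sup>2) \<le> 2 * \<gamma> * (?G \<omega> \<bullet> ?Y \<omega>)"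
      using \<gamma> by (intro mult_left_mono monotone) auto
    moreover have "2 * ((- \<gamma>) *\<^sub>R y \<bullet> (s - h)) = - (2 * \<gamma>) * (s \<bullet> y) + 2 * \<gamma> * (h \<bullet> y)"
      and "c * (norm ((- \<gamma>) *\<^sub>R y))\<^sup>2 = c * \<gamma>\<^sup>2 * (norm y)\<^sup>2" for y s h :: "real ^ 'd"
      by (simp_all add: power_mult_distrib inner_diff_right inner_commute algebra_simps)
    ultimately show ?thesis unfolding left_diff_distrib by (simp only: mult_ac)
  qed
  then have "expectation (\<lambda>\<omega>. - (2 * \<gamma>) * (?S \<omega> \<bullet> ?Y \<omega>))
      \<le> expectation (\<lambda>\<omega>. (c * \<gamma>\<^sup>2 - 2 * \<mu> * \<gamma>) * (norm (?Y \<omega>))\<^sup>2 + (1 / c) * (norm (?S \<omega> - ?G \<omega>))\<^sup>2)"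
    using square_integrable_inner[OF sqS Y] square_integrableD(2)[OF Y] square_integrableD(2)[OF sqD]
    by (intro integral_mono) auto
  also have "\<dots> = (c * \<gamma>\<^sup>2 - 2 * \<mu> * \<gamma>) * error k
      + (1 / c) * expectation (\<lambda>\<omega>. (norm (?S \<omega> - ?G \<omega>))\<^sup>2)"
    using square_integrableD(2)[OF Y] square_integrableD(2)[OF sqD] by (simp add: error_def)
  also have "\<dots> \<le> (c * \<gamma>\<^sup>2 - 2 * \<mu> * \<gamma>) * error k
      + (1 / c) * (real (card (conflict_pairs m a)) * L\<^sup>2 * \<gamma>\<^sup>2 * (real \<tau>)\<^sup>2 *
      (conflict_factor m a * \<alpha> * (2 * real m * L\<^sup>2 * B + 2 * gradient_noise)))"
    using c \<gamma> B by (intro add_left_mono mult_left_mono expected_stale_gradient_sum_error) auto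
  finally have cross: "- (2 * \<gamma>) * expectation (\<lambda>\<omega>. ?S \<omega> \<bullet> ?Y \<omega>) \<le> \<dots>"
    by simp
  have "\<gamma>\<^sup>2 * expectation (\<lambda>\<omega>. (norm (quantized_step k \<omega>))\<^sup>2) \<le> \<gamma>\<^sup>2 *
     (conflict_factor m a * \<alpha> * ((1 + t) * real m * L\<^sup>2 * B + (1 + 1 / t) * gradient_noise))"
    using B t by (intro mult_left_mono quantized_step_second_moment) auto
  moreover have "(1 - 2 * \<mu> * \<gamma> + c * \<gamma>\<^sup>2) * error k = error k + (c * \<gamma>\<^sup>2 - 2 * \<mu> * \<gamma>) * error k"
    by (simp add: algebra_simps)
  ultimately show ?thesis
    using cross unfolding error_Suc by linarith
qed

text \<open>A gradient that is \<mu>-strongly monotone cannot have a Lipschitz constant below \<mu>, and both ways of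
  estimating sums over the conflict graph give a Lipschitz constant of the total gradient.\<close>

lemma strong_monotonicity_constant_le:
  assumes "0 \<le> \<mu>" and stationary: "(\<Sum>i=1..m. g i xstar) = 0"
    and monotone: "\<And>y. \<mu> * (norm (y - xstar))\<^sup>2 \<le> (\<Sum>i=1..m. g i y) \<bullet> (y - xstar)"
  shows "\<mu>\<^sup>2 \<le> real (card (conflict_pairs m a)) * L\<^sup>2"
    and "\<mu>\<^sup>2 \<le> conflict_factor m a * (real m * L\<^sup>2)"
proof -
  obtain u :: "real ^ 'd" where u: "norm u = 1" using vector_choose_size[of 1] by auto
  let ?v = "\<lambda>i. g i (xstar + u) - g i xstar"
  have v: "norm (?v i) \<le> L" if "i \<in> {1..m}" for i
    using lipschitz_norm[OF that, of "xstar + u" xstar] u by simp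
  have "\<mu> \<le> (\<Sum>i=1..m. ?v i) \<bullet> u"
    using monotone[of "xstar + u"] u stationary by (simp add: sum_subtractf)
  also have "\<dots> \<le> norm (\<Sum>i=1..m. ?v i)"
    using norm_cauchy_schwarz[of "\<Sum>i=1..m. ?v i" u] u by simp
  finally have le: "\<mu>\<^sup>2 \<le> (norm (\<Sum>i=1..m. ?v i))\<^sup>2"
    using \<open>0 \<le> \<mu>\<close> by (rule power_mono)
  then show "\<mu>\<^sup>2 \<le> real (card (conflict_pairs m a)) * L\<^sup>2"
    by (rule order_trans) (intro norm_sum_le_card_conflict_pairs vsupp_gradient_diff v)
  have "(norm (\<Sum>i=1..m. ?v i))\<^sup>2 \<le> conflict_factor m a * (\<Sum>i=1..m. (norm (?v i))\<^sup>2)"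
    by (intro norm_sum_le_conflict_factor vsupp_gradient_diff m)
  also have "\<dots> \<le> conflict_factor m a * (\<Sum>i=1..m. L\<^sup>2)"
    by (intro mult_left_mono sum_mono power_mono v conflict_factor_nonneg norm_ge_zero)
  finally show "\<mu>\<^sup>2 \<le> conflict_factor m a * (real m * L\<^sup>2)" using le by simp
qed

end

section \<open>Linear recurrences with bounded delay\<close>

text \<open>A bound of the form \<open>C\<^sup>k V\<^sub>0 + e / (1 - r)\<close> with \<open>C = r powr (1 / (1 + T))\<close> is reproduced by
  the recurrence because the oldest error that enters step k + 1 has index at least k - T, and going
  from k - T to k + 1 costs exactly one factor r. For k < T the index 0 is the oldest one, and the
  exponent k - T is then negative, which only weakens the bound.\<close>

lemma delayed_recurrence_bound:
  fixes V :: "nat \<Rightarrow> real" and r e :: real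
  assumes r: "0 < r" "r < 1" and "0 \<le> e" and V0: "0 \<le> V 0"
    and step: "\<And>k B. (\<And>l. l \<le> k \<Longrightarrow> k \<le> l + T \<Longrightarrow> V l \<le> B) \<Longrightarrow> V (Suc k) \<le> r * B + e"
  shows "V k \<le> r powr (real k / (1 + real T)) * V 0 + e / (1 - r)"
proof (induction k rule: less_induct)
  case (less k)
  show ?case
  proof (cases k)
    case 0
    then show ?thesis using assms by simp
  next
    case (Suc n)
    \<comment> \<open>The exponent may be negative here; as r < 1 this only enlarges B.\<close>
    define B where "B = r powr ((real n - real T) / (1 + real T)) * V 0 + e / (1 - r)"
    have "V l \<le> B" if "l \<le> n" "n \<le> l + T" for l
    proof -
      have "r powr (real l / (1 + real T)) \<le> r powr ((real n - real T) / (1 + real T))"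
        using that r by (intro powr_mono' divide_right_mono) auto
      then have "r powr (real l / (1 + real T)) * V 0
          \<le> r powr ((real n - real T) / (1 + real T)) * V 0"
        using V0 by (rule mult_right_mono)
      with less.IH[of l] that Suc show ?thesis by (simp add: B_def)
    qed
    then have "V k \<le> r * B + e" unfolding Suc by (rule step)
    also have "\<dots> = r powr (1 + (real n - real T) / (1 + real T)) * V 0 + (r * (e / (1 - r)) + e)"
      using r by (simp add: B_def powr_add distrib_left)
    also have "1 + (real n - real T) / (1 + real T) = real k / (1 + real T)"
      by (simp add: Suc field_simps)
    also have "r * (e / (1 - r)) + e = e / (1 - r)" using r by (simp add: field_simps)
    finally show ?thesis .
  qed
qed

section \<open>Convergence of the quantized asynchronous gradient iteration\<close>

theorem theorem6p1:
  fixes f :: "nat \<Rightarrow> real ^ 'd \<Rightarrow> real"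
    and g :: "nat \<Rightarrow> real ^ 'd \<Rightarrow> real ^ 'd"
    and F :: "real ^ 'd \<Rightarrow> real"
    and l :: "real \<Rightarrow> real \<Rightarrow> real"
    and a :: "nat \<Rightarrow> real ^ 'd" and b :: "nat \<Rightarrow> real"
    and m \<tau> :: nat and delay :: "nat \<Rightarrow> nat \<Rightarrow> nat"
    and L \<mu> \<alpha> \<theta> \<gamma> \<Delta> Lbar \<sigma> \<gamma>bar p q e :: real
    and M :: "'w measure" and W :: "'s measure"
    and Q :: "'s \<Rightarrow> real ^ 'd \<Rightarrow> real ^ 'd"
    and \<xi> :: "nat \<Rightarrow> nat \<Rightarrow> 'w \<Rightarrow> 's"
    and x0 xstar :: "real ^ 'd" and x :: "int \<Rightarrow> 'w \<Rightarrow> real ^ 'd"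
  assumes "1 \<le> m"
    and F_def: "F = (\<lambda>y. \<Sum>i=1..m. f i y)"
    and gradient: "\<And>i y. i \<in> {1..m} \<Longrightarrow> GDERIV (f i) y :> g i y"
    and convex: "\<And>i. i \<in> {1..m} \<Longrightarrow> convex_on UNIV (f i)"
    and lipschitz_gradient: "\<And>i. i \<in> {1..m} \<Longrightarrow> L-lipschitz_on UNIV (g i)"
    and strong_convexity: "0 < \<mu>" "strongly_convex \<mu> F"
    and loss: "\<And>i y. i \<in> {1..m} \<Longrightarrow> f i y = l (a i \<bullet> y) (b i)"
    and gradient_support: "\<And>i y. i \<in> {1..m} \<Longrightarrow> vsupp (g i y) = vsupp (a i)"
    and minimizer: "\<And>y. F xstar \<le> F y"
    and \<Delta>_def: "\<Delta> = min (Delta_ave m a) (Delta_max m a)"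
    and Lbar_def: "Lbar = L * sqrt (real m * (1 + \<Delta>))"
    and \<sigma>_def: "\<sigma> = min (sqrt (real m * (1 + Delta_ave m a))) (1 + Delta_max m a)"
    and quantizer: "unbiased_random_quantizer W Q \<alpha>"
    and prob: "prob_space M"
    and seeds: "fresh_seeds M W m \<xi>"
    and delays: "\<And>k i. i \<in> {1..m} \<Longrightarrow> delay k i \<le> \<tau>"
    and "0 < \<theta>"
    and \<gamma>bar_def: "\<gamma>bar = 2 * \<mu> /
          (1 + real m * \<sigma> * \<alpha> * L\<^sup>2 * (2 * Lbar\<^sup>2 * (real \<tau>)\<^sup>2 + (1 + \<theta>)))"
    and step_size: "0 < \<gamma>" "\<gamma> < \<gamma>bar"
    and iterates: "quantized_delayed_iterates M Q \<xi> m g delay \<gamma> x0 x"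
    and p_def: "p = 1 - 2 * \<mu> * \<gamma> + \<gamma>\<^sup>2"
    and q_def: "q = 2 * real m * \<sigma> * \<alpha> * L\<^sup>2 * \<gamma>\<^sup>2 * Lbar\<^sup>2 * (real \<tau>)\<^sup>2
          + (1 + \<theta>) * \<gamma>\<^sup>2 * real m * \<alpha> * \<sigma> * L\<^sup>2"
    and e_def: "e = (2 * real m * \<alpha> * \<gamma>\<^sup>2 * Lbar\<^sup>2 * (real \<tau>)\<^sup>2
          + (1 + 1 / \<theta>) * \<gamma>\<^sup>2 * \<sigma> * \<alpha>) * (\<Sum>i=1..m. (norm (g i xstar))\<^sup>2)"
  shows "\<forall>k::nat.
      integrable M (\<lambda>\<omega>. (norm (x (int k) \<omega> - xstar))\<^sup>2) \<and>
      (\<integral>\<omega>. (norm (x (int k) \<omega> - xstar))\<^sup>2 \<partial>M)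
        \<le> (p + q) powr (real k / (1 + 2 * real \<tau>)) * (norm (x0 - xstar))\<^sup>2 + e / (1 - p - q)"
proof -
  let ?N = "real (card (conflict_pairs m a))"
  interpret M: prob_space M by (rule prob)
  interpret quantized_delayed_gradient M W Q \<xi> g a m \<tau> delay L \<alpha> \<gamma> x0 xstar x
    by unfold_locales (use \<open>1 \<le> m\<close> quantizer seeds iterates delays lipschitz_gradient gradient_support in auto)
  have dF: "GDERIV F y :> (\<Sum>i=1..m. g i y)" for y
    unfolding F_def using gradient by (intro GDERIV_sum) auto
  have stationary: "(\<Sum>i=1..m. g i xstar) = 0"
    using dF minimizer by (rule GDERIV_minimum_eq_0)
  have monotone: "\<mu> * (norm (y - xstar))\<^sup>2 \<le> (\<Sum>i=1..m. g i y) \<bullet> (y - xstar)" for y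
    using strongly_convex_strongly_monotone[OF strong_convexity(2) dF dF, of y xstar] stationary
    by simp
  have \<sigma>: "\<sigma> = conflict_factor m a" by (simp add: \<sigma>_def conflict_factor_def)
  have \<sigma>0: "0 \<le> \<sigma>" and \<sigma>_le: "\<sigma> \<le> real m"
    using conflict_factor_nonneg conflict_factor_le[OF \<open>1 \<le> m\<close>] by (simp_all add: \<sigma>)
  have "\<Delta> = Delta_ave m a"
    using Delta_ave_le_Delta_max[OF \<open>1 \<le> m\<close>, of a] by (simp add: \<Delta>_def)
  then have Lbar: "Lbar\<^sup>2 = ?N * L\<^sup>2"
    using card_conflict_pairs[OF \<open>1 \<le> m\<close>, of a]
    by (simp add: Lbar_def power_mult_distrib flip: \<open>\<Delta> = Delta_ave m a\<close>)
  have \<alpha>: "1 \<le> \<alpha>" using quantizer by (rule quantizer_variance_ge_1)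
  have \<mu>1: "\<mu>\<^sup>2 \<le> Lbar\<^sup>2" and \<mu>2: "\<mu>\<^sup>2 \<le> real m * \<sigma> * L\<^sup>2"
    using strong_monotonicity_constant_le[OF _ stationary monotone] strong_convexity(1)
    by (simp_all add: Lbar \<sigma> mult_ac)
  have \<mu>3: "\<mu>\<^sup>2 \<le> real m * \<sigma> * \<alpha> * L\<^sup>2"
  proof -
    have "real m * \<sigma> * L\<^sup>2 * 1 \<le> real m * \<sigma> * L\<^sup>2 * \<alpha>"
      using \<alpha> \<sigma>0 by (intro mult_left_mono) auto
    with \<mu>2 show ?thesis by (simp add: mult_ac)
  qed

  define q1 where "q1 = 2 * real m * \<sigma> * \<alpha> * L\<^sup>2 * \<gamma>\<^sup>2 * Lbar\<^sup>2 * (real \<tau>)\<^sup>2"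
  define q2 where "q2 = (1 + \<theta>) * \<gamma>\<^sup>2 * real m * \<alpha> * \<sigma> * L\<^sup>2"
  define e1 where "e1 = 2 * real m * \<alpha> * \<gamma>\<^sup>2 * Lbar\<^sup>2 * (real \<tau>)\<^sup>2 * gradient_noise"
  define e2 where "e2 = (1 + 1 / \<theta>) * \<gamma>\<^sup>2 * \<sigma> * \<alpha> * gradient_noise"
  have q: "q = q1 + q2" by (simp add: q_def q1_def q2_def)
  have e: "e = e1 + e2"
    unfolding e_def e1_def e2_def gradient_noise_def by (simp only: distrib_right)
  have pos: "0 \<le> q1" "0 \<le> q2" "0 \<le> e1" "0 \<le> e2"
    using \<alpha> \<sigma>0 \<open>0 < \<theta>\<close> gradient_noise_nonneg by (simp_all add: q1_def q2_def e1_def e2_def)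

  \<comment> \<open>The stale part of the noise is bounded using \<open>\<sigma> \<le> m\<close>, which gives e1.\<close>
  have step: "error (Suc k) \<le> (1 - 2 * \<mu> * \<gamma> + c * \<gamma>\<^sup>2) * error k + (q1 * B + e1) / c + (q2 * B + e2)"
    if "0 < c" and B: "\<And>l. l \<le> k \<Longrightarrow> k \<le> l + 2 * \<tau> \<Longrightarrow> error l \<le> B" for k B c
  proof -
    have "?N * L\<^sup>2 * \<gamma>\<^sup>2 * (real \<tau>)\<^sup>2 * (conflict_factor m a * \<alpha> * (2 * real m * L\<^sup>2 * B + 2 * gradient_noise))
        = q1 * B + \<sigma> * (2 * \<alpha> * \<gamma>\<^sup>2 * Lbar\<^sup>2 * (real \<tau>)\<^sup>2 * gradient_noise)"
      unfolding q1_def Lbar \<sigma> by (simp add: algebra_simps)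
    also have "\<dots> \<le> q1 * B + real m * (2 * \<alpha> * \<gamma>\<^sup>2 * Lbar\<^sup>2 * (real \<tau>)\<^sup>2 * gradient_noise)"
      using \<alpha> gradient_noise_nonneg by (intro add_left_mono mult_right_mono \<sigma>_le) auto
    also have "\<dots> = q1 * B + e1" by (simp add: e1_def)
    finally have "(1 / c) * (?N * L\<^sup>2 * \<gamma>\<^sup>2 * (real \<tau>)\<^sup>2 *
        (conflict_factor m a * \<alpha> * (2 * real m * L\<^sup>2 * B + 2 * gradient_noise))) \<le> (1 / c) * (q1 * B + e1)"
      using \<open>0 < c\<close> by (intro mult_left_mono) auto
    moreover have "\<gamma>\<^sup>2 * (conflict_factor m a * \<alpha> * ((1 + \<theta>) * real m * L\<^sup>2 * B + (1 + 1 / \<theta>) * gradient_noise))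
        = q2 * B + e2"
      unfolding q2_def e2_def \<sigma> by (simp only: distrib_left distrib_right mult_ac)
    ultimately show ?thesis
      using one_step_bound[OF _ \<open>0 < \<theta>\<close> \<open>0 < c\<close> monotone B] \<open>0 < \<gamma>\<close> by fastforce
  qed

  let ?D = "1 + real m * \<sigma> * \<alpha> * L\<^sup>2 * (2 * Lbar\<^sup>2 * (real \<tau>)\<^sup>2 + (1 + \<theta>))"
  have D: "1 + \<mu>\<^sup>2 \<le> ?D"
  proof -
    have "real m * \<sigma> * \<alpha> * L\<^sup>2 * 1 \<le> real m * \<sigma> * \<alpha> * L\<^sup>2 * (2 * Lbar\<^sup>2 * (real \<tau>)\<^sup>2 + (1 + \<theta>))"
      using \<alpha> \<sigma>0 \<open>0 < \<theta>\<close> by (intro mult_left_mono) auto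
    with \<mu>3 show ?thesis by simp
  qed
  have pq: "p + q = 1 - 2 * \<mu> * \<gamma> + \<gamma>\<^sup>2 * ?D"
    by (simp add: p_def q_def algebra_simps)
  have pq_less: "p + q < 1"
  proof -
    have "0 < ?D" using D zero_le_power2[of \<mu>] by linarith
    then have "\<gamma> * ?D < 2 * \<mu>" using step_size(2) by (simp add: \<gamma>bar_def pos_less_divide_eq)
    then have "\<gamma> * (\<gamma> * ?D) < \<gamma> * (2 * \<mu>)" using step_size(1) by (rule mult_strict_left_mono)
    then show ?thesis unfolding pq by (simp add: power2_eq_square mult_ac)
  qed
  \<comment> \<open>Strict positivity matters: the power of 0 would be 0 even for the exponent 0.\<close>
  have pq_pos: "0 < p + q"
  proof -
    have "0 < (1 - \<mu> * \<gamma>)\<^sup>2 + \<gamma>\<^sup>2" using \<open>0 < \<gamma>\<close> by (simp add: add_nonneg_pos)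
    also have "\<dots> = 1 - 2 * \<mu> * \<gamma> + \<gamma>\<^sup>2 * (1 + \<mu>\<^sup>2)"
      by (simp add: power2_eq_square algebra_simps)
    also have "\<dots> \<le> p + q" unfolding pq using D by (intro add_left_mono mult_left_mono) auto
    finally show ?thesis .
  qed

  have rec: "error (Suc k) \<le> (p + q) * B + e"
    if B: "\<And>l. l \<le> k \<Longrightarrow> k \<le> l + 2 * \<tau> \<Longrightarrow> error l \<le> B" for k B
  proof -
    have k: "error k \<le> B" using B by simp
    have B0: "0 \<le> B" using k error_nonneg[of k] by simp
    \<comment> \<open>If p is negative, then the bound by B of the current error cannot be used in the term with
      coefficient p, and the cases differ.\<close>
    consider "0 \<le> p" | "p < 0" "\<tau> = 0" | "p < 0" "1 \<le> \<tau>" by linarith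
    then show ?thesis
    proof cases
      case 1
      have "error (Suc k) \<le> p * error k + (q1 * B + e1) + (q2 * B + e2)"
        using step[OF zero_less_one B] by (simp add: p_def)
      moreover have "p * error k \<le> p * B" using k 1 by (rule mult_left_mono)
      ultimately show ?thesis by (simp add: q e algebra_simps)
    next
      case 2
      \<comment> \<open>Without delays the current error is the only one that enters, and it can be taken as bound.\<close>
      have "error (Suc k) \<le> p * error k + (q1 * error k + e1) + (q2 * error k + e2)"
        using step[OF zero_less_one, of k "error k"] 2 by (simp add: p_def)
      moreover have "(p + q) * error k \<le> (p + q) * B" using pq_pos k by (intro mult_left_mono) auto
      ultimately show ?thesis by (simp add: q e algebra_simps)
    next
      case 3
      \<comment> \<open>This weight in Young's inequality makes the coefficient of the current error vanish. The
        price is paid by q1, which is large enough: step sizes with negative p force \<open>\<mu> > 1\<close>.\<close>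
      define c where "c = (2 * \<mu> * \<gamma> - 1) / \<gamma>\<^sup>2"
      have c: "c * \<gamma>\<^sup>2 = 2 * \<mu> * \<gamma> - 1" using \<open>0 < \<gamma>\<close> by (simp add: c_def)
      have c1: "1 < c" using 3 \<open>0 < \<gamma>\<close> by (simp add: c_def p_def)
      have "1 < \<mu>\<^sup>2"
      proof -
        have "0 \<le> (\<gamma> - \<mu>)\<^sup>2" by simp
        also have "\<dots> = p - 1 + \<mu>\<^sup>2" by (simp add: p_def power2_eq_square algebra_simps)
        finally show ?thesis using 3 by simp
      qed
      have "c * \<gamma>\<^sup>2 \<le> q1"
      proof -
        have "0 \<le> (\<mu> * \<gamma>)\<^sup>2 + (\<mu> * \<gamma> - 1)\<^sup>2" by simp
        also have "\<dots> = 2 * (\<mu>\<^sup>2 * \<gamma>\<^sup>2) - c * \<gamma>\<^sup>2" unfolding c by (simp add: power2_eq_square algebra_simps)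
        finally have "c * \<gamma>\<^sup>2 \<le> 2 * (\<mu>\<^sup>2 * \<gamma>\<^sup>2) * 1" by simp
        also have "\<dots> \<le> 2 * (\<mu>\<^sup>2 * \<gamma>\<^sup>2) * \<mu>\<^sup>2" using \<open>1 < \<mu>\<^sup>2\<close> by (intro mult_left_mono) auto
        also have "\<dots> = 2 * \<gamma>\<^sup>2 * (\<mu>\<^sup>2 * \<mu>\<^sup>2 * 1)" by simp
        also have "\<dots> \<le> 2 * \<gamma>\<^sup>2 * (real m * \<sigma> * \<alpha> * L\<^sup>2 * Lbar\<^sup>2 * (real \<tau>)\<^sup>2)"
          using 3 \<mu>1 \<mu>3 \<alpha> \<sigma>0 by (intro mult_left_mono mult_mono) auto
        also have "\<dots> = q1" by (simp add: q1_def)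
        finally show ?thesis .
      qed
      then have "c * \<gamma>\<^sup>2 * (1 - 1 / c) \<le> q1 * (1 - 1 / c)"
        using c1 by (intro mult_right_mono) auto
      moreover have "c * \<gamma>\<^sup>2 * (1 - 1 / c) = - p"
      proof -
        have "c * \<gamma>\<^sup>2 * (1 - 1 / c) = c * \<gamma>\<^sup>2 - \<gamma>\<^sup>2" using c1 by (simp add: right_diff_distrib)
        then show ?thesis unfolding c by (simp add: p_def)
      qed
      ultimately have "q1 / c \<le> p + q1" by (simp add: right_diff_distrib)
      then have "q1 / c * B \<le> (p + q1) * B" using B0 by (rule mult_right_mono)
      moreover have "e1 / c \<le> e1" using c1 pos(3) by (simp add: divide_le_eq mult_le_cancel_left1)
      moreover have "error (Suc k) \<le> (q1 * B + e1) / c + (q2 * B + e2)"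
        using step[of c k B] B c1 by (simp add: c)
      ultimately show ?thesis by (simp add: q e add_divide_distrib algebra_simps)
    qed
  qed
  show ?thesis
  proof
    fix k
    have "error k \<le> (p + q) powr (real k / (1 + real (2 * \<tau>))) * error 0 + e / (1 - (p + q))"
      using pq_pos pq_less pos e rec by (intro delayed_recurrence_bound error_nonneg) auto
    moreover have "error 0 = (norm (x0 - xstar))\<^sup>2"
      unfolding error_def
      by (subst Bochner_Integration.integral_cong[OF refl, of _ _ "\<lambda>_. (norm (x0 - xstar))\<^sup>2"])
        (simp_all add: X_0 M.prob_space)
    ultimately have "error k \<le> (p + q) powr (real k / (1 + 2 * real \<tau>)) * (norm (x0 - xstar))\<^sup>2 + e / (1 - p - q)"
      by (simp add: diff_diff_eq)
    then show "integrable M (\<lambda>\<omega>. (norm (x (int k) \<omega> - xstar))\<^sup>2) \<and>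
      (\<integral>\<omega>. (norm (x (int k) \<omega> - xstar))\<^sup>2 \<partial>M)
        \<le> (p + q) powr (real k / (1 + 2 * real \<tau>)) * (norm (x0 - xstar))\<^sup>2 + e / (1 - p - q)"
      using square_integrableD(2)[OF square_integrable_error[of k xstar]]
      by (simp add: error_def X_def)
  qed
qed

end
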